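(* Every minimal tame metric topological dynamical system $(K;S)$ with $S$ amenable is uniquely ergodic.
   Context: Compact spaces are Hausdorff, and $K$ is non-empty; vector spaces are complex. A semitopological semigroup $S$ (separately continuous multiplication) is amenable if $\mathrm{C}_{\mathrm{b}}(S)$ (bounded continuous functions) has a two-sided invariant mean: a positive $m\in\mathrm{C}_{\mathrm{b}}(S)'$ with $m(\mathbf{1})=1$, $m(L_sf)=m(f)$ and $m(R_sf)=m(f)$ for all $f,s$, where $L_sf(t)=f(st)$, $R_sf(t)=f(ts)$. A topological dynamical system $(K;S)$ is a compact space $K$ with a semitopological semigroup $S$ acting on $K$ such that $S\times K\to K$, $(s,x)\mapsto sx$ is continuous; it is metric if $K$ is metrizable. It is minimal if $K$ has no non-trivial (i.e. different from $\emptyset$ and $K$) closed $S$-invariant subsets. A metric system is tame if for each $f\in\mathrm{C}(K)$ the orbit $\{T_sf\mid s\in S\}$, $T_sf(x)=f(sx)$, is relatively sequentially compact in $\mathbb{C}^K$ with the product topology (every sequence in the orbit has a subsequence converging in $\mathbb{C}^K$). $(K;S)$ is uniquely ergodic if there is a unique $S$-invariant (regular Borel) probability measure $\mu\in\mathrm{C}(K)'$, where $S$-invariant means $T_s'\mu=\mu$ for all $s\in S$. *)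

theory Defs
  imports "HOL-Probability.Probability"
begin

class semitopological_semigroup = semigroup_mult + topological_space +
  assumes continuous_mult_left: "open U \<Longrightarrow> open ((\<lambda>t. s * t) -` U)"
    and continuous_mult_right: "open U \<Longrightarrow> open ((\<lambda>t. t * s) -` U)"

text \<open>
  The library set \<^term>\<open>bcontfun\<close> of bounded continuous functions \<open>S \<Rightarrow> \<complex>\<close> is the space
  \<open>C\<^sub>b(S)\<close>.  A functional on it is represented by a map on all functions that is
  constrained only on \<^term>\<open>bcontfun\<close>.
\<close>

definition Cb_dual :: "(('s::topological_space \<Rightarrow> complex) \<Rightarrow> complex) set" where
  "Cb_dual = {m.
     (\<forall>f\<in>bcontfun. \<forall>g\<in>bcontfun. m (\<lambda>t. f t + g t) = m f + m g) \<and>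
     (\<forall>c. \<forall>f\<in>bcontfun. m (\<lambda>t. c * f t) = c * m f) \<and>
     (\<exists>B. \<forall>f\<in>bcontfun. cmod (m f) \<le> B * (SUP t. cmod (f t)))}"

definition left_translate :: "'s::times \<Rightarrow> ('s \<Rightarrow> complex) \<Rightarrow> 's \<Rightarrow> complex" where
  "left_translate s f = (\<lambda>t. f (s * t))"

definition right_translate :: "'s::times \<Rightarrow> ('s \<Rightarrow> complex) \<Rightarrow> 's \<Rightarrow> complex" where
  "right_translate s f = (\<lambda>t. f (t * s))"

definition invariant_mean :: "(('s::semitopological_semigroup \<Rightarrow> complex) \<Rightarrow> complex) \<Rightarrow> bool" where
  "invariant_mean m \<longleftrightarrow>
     m \<in> Cb_dual \<and>
     (\<forall>f\<in>bcontfun. (\<forall>t. f t \<in> \<real>\<^sub>\<ge>\<^sub>0) \<longrightarrow> m f \<in> \<real>\<^sub>\<ge>\<^sub>0) \<and>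
     m (\<lambda>_. 1) = 1 \<and>
     (\<forall>f\<in>bcontfun. \<forall>s. m (left_translate s f) = m f \<and> m (right_translate s f) = m f)"

definition amenable :: "'s::semitopological_semigroup itself \<Rightarrow> bool" where
  "amenable _ \<longleftrightarrow> (\<exists>m :: ('s \<Rightarrow> complex) \<Rightarrow> complex. invariant_mean m)"

text \<open>
  The space \<open>K\<close> is the whole type \<open>'k\<close>, hence non-empty; it is Hausdorff by its sort.
  \<open>S\<close> need not have a unit.
\<close>

locale topological_dynamical_system =
  fixes act :: "'s::semitopological_semigroup \<Rightarrow> 'k::t2_space \<Rightarrow> 'k"
  assumes compact_UNIV: "compact (UNIV :: 'k set)"
    and act_mult: "act (s * t) x = act s (act t x)"
    and continuous_act: "continuous_on UNIV (\<lambda>(s, x). act s x)"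

definition metric_system :: "('s \<Rightarrow> 'k::topological_space \<Rightarrow> 'k) \<Rightarrow> bool" where
  "metric_system act \<longleftrightarrow> metrizable_space (euclidean :: 'k topology)"

definition minimal_system :: "('s \<Rightarrow> 'k::topological_space \<Rightarrow> 'k) \<Rightarrow> bool" where
  "minimal_system act \<longleftrightarrow>
     (\<forall>C. closed C \<and> (\<forall>s. act s ` C \<subseteq> C) \<longrightarrow> C = {} \<or> C = UNIV)"

definition koopman :: "('s \<Rightarrow> 'k \<Rightarrow> 'k) \<Rightarrow> 's \<Rightarrow> ('k \<Rightarrow> complex) \<Rightarrow> 'k \<Rightarrow> complex" where
  "koopman act s f = (\<lambda>x. f (act s x))"

definition relatively_seq_compact :: "'a::topological_space set \<Rightarrow> bool" where
  "relatively_seq_compact A \<longleftrightarrow>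
     (\<forall>u :: nat \<Rightarrow> 'a. range u \<subseteq> A \<longrightarrow> (\<exists>l r. strict_mono r \<and> (u \<circ> r) \<longlonglongrightarrow> l))"

text \<open>
  The topology on \<open>'k \<Rightarrow> complex\<close> is the product topology (the library's instance for
  function types); the limit of a subsequence need not be continuous.
\<close>

definition tame :: "('s \<Rightarrow> 'k::topological_space \<Rightarrow> 'k) \<Rightarrow> bool" where
  "tame act \<longleftrightarrow>
     (\<forall>f. continuous_on UNIV f \<longrightarrow> relatively_seq_compact (range (\<lambda>s. koopman act s f)))"

definition regular_borel_probability :: "'k::topological_space measure \<Rightarrow> bool" where
  "regular_borel_probability \<mu> \<longleftrightarrow>
     sets \<mu> = sets borel \<and> prob_space \<mu> \<and>
     (\<forall>A\<in>sets borel.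
        emeasure \<mu> A = (SUP C\<in>{C. C \<subseteq> A \<and> compact C}. emeasure \<mu> C) \<and>
        emeasure \<mu> A = (INF U\<in>{U. A \<subseteq> U \<and> open U}. emeasure \<mu> U))"

text \<open>
  \<open>\<mu>\<close> acts on \<open>C(K)\<close> by integration, so \<open>T\<^sub>s' \<mu> = \<mu>\<close> says that \<open>T\<^sub>s f\<close> and \<open>f\<close> have the same
  integral for every \<open>f \<in> C(K)\<close>.
\<close>

definition invariant_measure :: "('s \<Rightarrow> 'k::topological_space \<Rightarrow> 'k) \<Rightarrow> 'k measure \<Rightarrow> bool" where
  "invariant_measure act \<mu> \<longleftrightarrow>
     (\<forall>s. \<forall>f. continuous_on UNIV f \<longrightarrow> integral\<^sup>L \<mu> (koopman act s f) = integral\<^sup>L \<mu> f)"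

definition uniquely_ergodic :: "('s \<Rightarrow> 'k::topological_space \<Rightarrow> 'k) \<Rightarrow> bool" where
  "uniquely_ergodic act \<longleftrightarrow> (\<exists>!\<mu>. regular_borel_probability \<mu> \<and> invariant_measure act \<mu>)"

end

theory Submission
  imports Defs
begin

text \<open>
  Existence. For a point x0 and an invariant mean M, the functional g \<mapsto> M (s \<mapsto> g (s x0)) on
  real continuous functions is positive and normalised, and left invariance of M makes it
  invariant under the action. The Riesz representation theorem turns it into a regular invariant
  probability measure (lemma exists_invariant_probability). The representing measure is obtained
  by Caratheodory's construction from the content U \<mapsto> sup {\<phi> f | 0 \<le> f \<le> 1_U} of open sets.

  Uniqueness. By regularity it suffices that two invariant measures \<mu> and \<nu> give the same integral
  to each real continuous f. Suppose \<integral>f d\<mu> < a < b < \<integral>f d\<nu>, and let H be the convex hull of the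
  orbit of f.

  Tameness and dominated convergence make the orbit totally bounded in L1(\<mu>) and in L1(\<nu>), so that
  the invariant mean of the orbit can be approximated by one finite convex combination h \<in> H in
  both norms at once; right invariance then makes h almost invariant in both norms
  (almost_invariant_average). As h has the same integrals as f, it is below a somewhere and above b
  somewhere. By minimality finitely many translates of a nonempty open set U cover the space, and
  almost invariance carries these two properties into U. Hence for any finitely many nonempty
  open sets there is a single h \<in> H with h < a at some point of each of them and h > b at another
  (distinct_integrals_split_open_sets).

  Iterating this along the binary tree gives h_0, h_1, ... in H and a map \<theta> from the Cantor space
  {0,1}^\<nat> to the compact metric space such that h_n \<circ> \<theta> exceeds b or falls below a according to
  the n-th coordinate (independent_sequence). For the fair coin measure the functions h_n \<circ> \<theta> have
  mutual L1-distance at least (b - a) / 4. But the orbit of f, pulled back along \<theta>, is totally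
  bounded in L1 of the coin measure, again by tameness and dominated convergence, and so is
  its convex hull. This contradiction (hull_not_splitting) finishes the proof. The tree
  construction and the pullback take the place of the theorem of Bourgain, Fremlin and Talagrand
  on pointwise compact sets of functions of the first Baire class.
\<close>

section \<open>The Riesz representation theorem on a compact Hausdorff space\<close>

lemma continuous_bounded:
  fixes f :: "'k::topological_space \<Rightarrow> real"
  assumes comp: "compact (UNIV :: 'k set)" and f: "continuous_on UNIV f"
  obtains B where "0 < B" "\<And>x. \<bar>f x\<bar> \<le> B"
proof -
  have "bounded (range f)"
    using compact_continuous_image[OF f comp] by (rule compact_imp_bounded)
  then show ?thesis using that by (auto simp: bounded_pos)
qed

lemma compact_Urysohn:
  fixes C U :: "'k::t2_space set"
  assumes comp: "compact (UNIV :: 'k set)" and C: "closed C" and U: "open U" and sub: "C \<subseteq> U"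
  obtains g :: "'k \<Rightarrow> real" where "continuous_on UNIV g" "\<And>x. 0 \<le> g x" "\<And>x. g x \<le> 1"
    "\<And>x. x \<in> C \<Longrightarrow> g x = 1" "\<And>x. x \<notin> U \<Longrightarrow> g x = 0"
proof -
  have "compact_space (euclidean :: 'k topology)"
    using comp by (simp add: compact_space_def)
  moreover have "Hausdorff_space (euclidean :: 'k topology)"
    unfolding Hausdorff_space_def disjnt_def using hausdorff[where 'a='k] by fastforce
  ultimately have "normal_space (euclidean :: 'k topology)"
    by (intro compact_Hausdorff_or_regular_imp_normal_space) auto
  moreover have "closedin euclidean (- U)" "closedin euclidean C" "disjnt (- U) C"
    using C U sub by (auto simp: disjnt_def closed_closedin[symmetric])
  ultimately obtain g where g: "continuous_map (euclidean :: 'k topology) (top_of_set {0..1::real}) g"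
    and g0: "g ` (- U) \<subseteq> {0}" and g1: "g ` C \<subseteq> {1}"
    by (rule Urysohn_lemma[of euclidean "- U" C 0 1]) auto
  have "continuous_on UNIV g" "g ` UNIV \<subseteq> {0..1}"
    using g by (auto simp: continuous_map_in_subtopology)
  then show ?thesis
    using g0 g1 by (intro that[of g]) (auto simp: image_subset_iff)
qed

text \<open>
  A normalised positive functional on the real continuous functions of a compact space. It is a map
  on all functions, of which only the values at continuous functions are constrained.
\<close>

locale positive_functional =
  fixes \<phi> :: "('k::t2_space \<Rightarrow> real) \<Rightarrow> real"
  assumes compact_space_UNIV: "compact (UNIV :: 'k set)"
    and add: "continuous_on UNIV f \<Longrightarrow> continuous_on UNIV g \<Longrightarrow> \<phi> (\<lambda>x. f x + g x) = \<phi> f + \<phi> g"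
    and scale: "continuous_on UNIV f \<Longrightarrow> \<phi> (\<lambda>x. c * f x) = c * \<phi> f"
    and nonneg: "continuous_on UNIV f \<Longrightarrow> (\<And>x. 0 \<le> f x) \<Longrightarrow> 0 \<le> \<phi> f"
    and one: "\<phi> (\<lambda>_. 1) = 1"
begin

lemma const: "\<phi> (\<lambda>_. c) = c"
  using scale[of "\<lambda>_. 1" c] one by simp

lemma diff:
  assumes "continuous_on UNIV f" "continuous_on UNIV g"
  shows "\<phi> (\<lambda>x. f x - g x) = \<phi> f - \<phi> g"
  using add[of f "\<lambda>x. (- 1) * g x"] scale[of g "- 1"] assms by (simp add: continuous_on_minus)

lemma mono:
  assumes "continuous_on UNIV f" "continuous_on UNIV g" "\<And>x. f x \<le> g x"
  shows "\<phi> f \<le> \<phi> g"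
  using nonneg[of "\<lambda>x. g x - f x"] diff[of g f] assms by (simp add: continuous_on_diff)

text \<open>
  The continuous functions between 0 and the indicator function of U. Their supports may touch the
  boundary of U; compactness is recovered by passing to the level sets f \<ge> e, see cut below.
\<close>

definition test :: "'k set \<Rightarrow> ('k \<Rightarrow> real) set" where
  "test U = {f. continuous_on UNIV f \<and> (\<forall>x. 0 \<le> f x \<and> f x \<le> 1) \<and> (\<forall>x. x \<notin> U \<longrightarrow> f x = 0)}"

definition content :: "'k set \<Rightarrow> ennreal" where
  "content U = (SUP f\<in>test U. ennreal (\<phi> f))"

definition outer :: "'k set \<Rightarrow> ennreal" where
  "outer A = (INF U\<in>{U. open U \<and> A \<subseteq> U}. content U)"

lemma testD:
  assumes "f \<in> test U"
  shows "continuous_on UNIV f" "0 \<le> f x" "f x \<le> 1" "x \<notin> U \<Longrightarrow> f x = 0" "0 \<le> \<phi> f"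
  using assms nonneg[of f] by (auto simp: test_def)

lemma zero_test: "(\<lambda>_. 0) \<in> test U"
  by (simp add: test_def)

lemma le_content: "f \<in> test U \<Longrightarrow> ennreal (\<phi> f) \<le> content U"
  unfolding content_def by (rule SUP_upper)

lemma content_mono: "U \<subseteq> V \<Longrightarrow> content U \<le> content V"
  unfolding content_def by (rule SUP_subset_mono) (auto simp: test_def)

lemma content_UNIV: "content UNIV = 1"
proof (rule antisym)
  show "content UNIV \<le> 1"
    unfolding content_def
  proof (rule SUP_least)
    fix f assume "f \<in> test UNIV"
    then have "\<phi> f \<le> 1"
      using mono[of f "\<lambda>_. 1"] one by (auto simp: test_def)
    then show "ennreal (\<phi> f) \<le> 1" by (simp add: ennreal_le_1)
  qed
  show "1 \<le> content UNIV"
    using le_content[of "\<lambda>_. 1" UNIV] one by (simp add: test_def)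
qed

lemma content_empty: "content {} = 0"
proof -
  have "\<phi> f = 0" if "f \<in> test {}" for f
  proof -
    have "f = (\<lambda>_. 0)" using that by (auto simp: test_def)
    then show ?thesis using const[of 0] by simp
  qed
  then show ?thesis unfolding content_def by (auto simp: SUP_eq_iff intro!: antisym SUP_least)
qed

text \<open>
  If f \<in> test U and e > 0, then the positive part of f - e vanishes off the compact set {f \<ge> e}, which lies
  inside U, while the functional changes by at most e.
\<close>

definition cut :: "real \<Rightarrow> ('k \<Rightarrow> real) \<Rightarrow> 'k \<Rightarrow> real" where
  "cut e f = (\<lambda>x. max (f x - e) 0)"

lemma continuous_cut: "continuous_on UNIV f \<Longrightarrow> continuous_on UNIV (cut e f)"
  unfolding cut_def by (intro continuous_intros)

lemma le_cut:
  assumes "continuous_on UNIV f"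
  shows "\<phi> f \<le> \<phi> (cut e f) + e"
proof -
  have "\<phi> f \<le> \<phi> (\<lambda>x. cut e f x + e)"
    by (rule mono) (auto intro!: continuous_intros continuous_cut assms simp: cut_def)
  also have "\<dots> = \<phi> (cut e f) + e"
    using add[of "cut e f" "\<lambda>_. e"] continuous_cut[OF assms] const[of e] by simp
  finally show ?thesis .
qed

lemma compact_level: "continuous_on UNIV f \<Longrightarrow> compact {x::'k. e \<le> (f x :: real)}"
  using closed_Int_compact[OF closed_Collect_le[of "\<lambda>_. e" f] compact_space_UNIV]
  by (simp add: continuous_on_const)

text \<open>
  A two-piece partition of unity: with C = {f \<ge> e} - V, a Urysohn function g that is 1 on C and 0
  off U splits cut e f into a part living in U and a part living in V.
\<close>

lemma content_Un:
  assumes U: "open U" and V: "open V"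
  shows "content (U \<union> V) \<le> content U + content V"
  unfolding content_def[of "U \<union> V"]
proof (rule SUP_least)
  fix f assume f: "f \<in> test (U \<union> V)"
  show "ennreal (\<phi> f) \<le> content U + content V"
  proof (rule ennreal_le_epsilon)
    fix e :: real assume e: "0 < e"
    let ?C = "{x. e \<le> f x} - V"
    have "compact ?C" using compact_level[OF testD(1)[OF f]] V by (rule compact_diff)
    moreover have "?C \<subseteq> U" using f e by (force simp: test_def)
    ultimately obtain g :: "'k \<Rightarrow> real" where g: "continuous_on UNIV g" "\<And>x. 0 \<le> g x" "\<And>x. g x \<le> 1"
      "\<And>x. x \<in> ?C \<Longrightarrow> g x = 1" "\<And>x. x \<notin> U \<Longrightarrow> g x = 0"
      using compact_Urysohn[OF compact_space_UNIV compact_imp_closed U] by metis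
    note cf = testD(1)[OF f] and cc = continuous_cut[OF testD(1)[OF f], of e]
    have c01: "0 \<le> cut e f x" "cut e f x \<le> 1" for x
      using testD(2,3)[OF f, of x] e by (auto simp: cut_def)
    have t1: "(\<lambda>x. cut e f x * g x) \<in> test U"
      using c01 g by (auto simp: test_def intro!: continuous_intros cc mult_le_one)
    have t2: "(\<lambda>x. cut e f x * (1 - g x)) \<in> test V"
    proof -
      have "cut e f x * (1 - g x) = 0" if "x \<notin> V" for x
        using that g(4)[of x] by (cases "e \<le> f x") (auto simp: cut_def)
      then show ?thesis
        using c01 g by (auto simp: test_def intro!: continuous_intros cc mult_le_one)
    qed
    have "\<phi> f \<le> \<phi> (cut e f) + e" by (rule le_cut[OF cf])
    also have "\<phi> (cut e f) = \<phi> (\<lambda>x. cut e f x * g x + cut e f x * (1 - g x))"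
      by (simp add: algebra_simps)
    also have "\<dots> = \<phi> (\<lambda>x. cut e f x * g x) + \<phi> (\<lambda>x. cut e f x * (1 - g x))"
      by (rule add) (use t1 t2 in \<open>auto simp: test_def\<close>)
    finally have "ennreal (\<phi> f) \<le> ennreal (\<phi> (\<lambda>x. cut e f x * g x)) + ennreal (\<phi> (\<lambda>x. cut e f x * (1 - g x))) + ennreal e"
      using testD(5)[OF t1] testD(5)[OF t2] e by (simp add: ennreal_plus[symmetric] del: ennreal_plus)
    also have "\<dots> \<le> content U + content V + ennreal e"
      by (intro add_mono le_content t1 t2 order_refl)
    finally show "ennreal (\<phi> f) \<le> content U + content V + ennreal e" .
  qed
qed

lemma content_UN_finite:
  assumes "\<And>i. open (U i)"
  shows "content (\<Union>i<n::nat. U i) \<le> (\<Sum>i<n. content (U i))"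
proof (induction n)
  case (Suc n)
  have "content (\<Union>i<Suc n. U i) \<le> content (\<Union>i<n. U i) + content (U n)"
    using content_Un[of "\<Union>i<n. U i" "U n"] assms by (simp add: lessThan_Suc Un_commute open_UN)
  with Suc show ?case by (auto intro: order_trans add_right_mono)
qed (simp add: content_empty)

text \<open>
  The level set {f \<ge> e} is compact, so only finitely many of the sets matter.
\<close>

lemma content_UN:
  assumes U: "\<And>i::nat. open (U i)"
  shows "content (\<Union>i. U i) \<le> (\<Sum>i. content (U i))"
  unfolding content_def[of "\<Union>i. U i"]
proof (rule SUP_least)
  fix f assume f: "f \<in> test (\<Union>i. U i)"
  show "ennreal (\<phi> f) \<le> (\<Sum>i. content (U i))"
  proof (rule ennreal_le_epsilon)
    fix e :: real assume e: "0 < e"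
    have "{x. e \<le> f x} \<subseteq> (\<Union>i. U i)" using f e by (force simp: test_def)
    then obtain I where I: "finite I" "{x. e \<le> f x} \<subseteq> (\<Union>i\<in>I. U i)"
      using compactE_image[OF compact_level[OF testD(1)[OF f]], of UNIV U e] U by metis
    then obtain n where n: "I \<subseteq> {..<n}" using finite_nat_bounded by blast
    have "cut e f x = 0" if "x \<notin> (\<Union>i<n. U i)" for x
      using that n I(2) by (force simp: cut_def)
    moreover have "0 \<le> cut e f x" "cut e f x \<le> 1" for x
      using testD(2,3)[OF f, of x] e by (auto simp: cut_def)
    ultimately have t: "cut e f \<in> test (\<Union>i<n. U i)"
      using continuous_cut[OF testD(1)[OF f], of e] by (simp add: test_def)
    have "ennreal (\<phi> f) \<le> ennreal (\<phi> (cut e f)) + ennreal e"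
      using le_cut[OF testD(1)[OF f], of e] testD(5)[OF t] e by (simp add: ennreal_plus[symmetric] del: ennreal_plus)
    also have "ennreal (\<phi> (cut e f)) \<le> (\<Sum>i<n. content (U i))"
      using le_content[OF t] content_UN_finite[of U n] U by (meson order_trans)
    also have "\<dots> \<le> (\<Sum>i. content (U i))" by (rule sum_le_suminf) auto
    finally show "ennreal (\<phi> f) \<le> (\<Sum>i. content (U i)) + ennreal e" by (simp add: add_right_mono)
  qed
qed

lemma outer_open: "open U \<Longrightarrow> outer U = content U"
  unfolding outer_def by (rule antisym) (auto intro!: INF_lower INF_greatest content_mono)

lemma outer_mono: "A \<subseteq> B \<Longrightarrow> outer A \<le> outer B"
  unfolding outer_def by (rule INF_superset_mono) auto

lemma outer_le_1: "outer A \<le> 1"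
  using outer_mono[of A UNIV] outer_open[of UNIV] content_UNIV by simp

lemma outer_approx:
  assumes "0 < e"
  obtains U where "open U" "A \<subseteq> U" "content U \<le> outer A + ennreal e"
proof -
  have "outer A < outer A + ennreal e"
    using assms outer_le_1[of A] by (cases "outer A") (auto simp: ennreal_plus[symmetric] ennreal_lessI top_unique simp del: ennreal_plus)
  then obtain U where "open U" "A \<subseteq> U" "content U < outer A + ennreal e"
    by (auto simp: outer_def[of A] INF_less_iff)
  then show ?thesis by (intro that[of U]) auto
qed

lemma outer_UN: "outer (\<Union>i. A i) \<le> (\<Sum>i::nat. outer (A i))"
proof (rule ennreal_le_epsilon)
  fix e :: real assume e: "0 < e"
  have "\<exists>U. open U \<and> A i \<subseteq> U \<and> content U \<le> outer (A i) + ennreal (e * (1/2)^Suc i)" for i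
    using outer_approx[of "e * (1/2)^Suc i" "A i"] e by force
  then obtain U where U: "\<And>i. open (U i)" "\<And>i. A i \<subseteq> U i"
    "\<And>i. content (U i) \<le> outer (A i) + ennreal (e * (1/2)^Suc i)" by metis
  have "outer (\<Union>i. A i) \<le> outer (\<Union>i. U i)" using U(2) by (intro outer_mono) blast
  also have "\<dots> \<le> (\<Sum>i. content (U i))" using content_UN[of U] U(1) by (simp add: outer_open open_UN)
  also have "\<dots> \<le> (\<Sum>i. outer (A i) + ennreal (e * (1/2)^Suc i))"
    by (intro suminf_le U(3)) auto
  also have "\<dots> = (\<Sum>i. outer (A i)) + (\<Sum>i. ennreal (e * (1/2)^Suc i))"
    by (rule suminf_add[symmetric]) auto
  also have "(\<Sum>i. ennreal (e * (1/2)^Suc i)) = ennreal e"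
    using sums_mult[OF power_half_series, of e] e by (intro suminf_ennreal_eq) auto
  finally show "outer (\<Union>i. A i) \<le> (\<Sum>i. outer (A i)) + ennreal e" .
qed

lemma outer_measure_space_outer: "outer_measure_space UNIV outer"
proof -
  have "outer {} = 0" by (simp add: outer_open content_empty)
  then show ?thesis
    unfolding outer_measure_space_def positive_def increasing_def countably_subadditive_def
    by (intro conjI ballI allI impI outer_mono outer_UN)
qed

text \<open>
  Caratheodory's criterion for U reduces to testing with open sets V. There, a test
  function f for V \<inter> U is cut at level e, and the open set W = V - {f \<ge> e} still contains V - U; a
  test function for W can be added to cut e f without exceeding 1.
\<close>

lemma open_in_lambda_system:
  assumes U: "open U"
  shows "U \<in> lambda_system UNIV UNIV outer"
proof -
  have le: "content (V \<inter> U) + outer (V - U) \<le> content V" if V: "open V" for V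
  proof -
    have "content (V \<inter> U) + outer (V - U) = (SUP f\<in>test (V \<inter> U). ennreal (\<phi> f) + outer (V - U))"
      unfolding content_def by (rule ennreal_SUP_add_left[symmetric]) (use zero_test in blast)
    also have "\<dots> \<le> content V"
    proof (rule SUP_least)
      fix f assume f: "f \<in> test (V \<inter> U)"
      show "ennreal (\<phi> f) + outer (V - U) \<le> content V"
      proof (rule ennreal_le_epsilon)
        fix e :: real assume e: "0 < e"
        define W where "W = V - {x. e \<le> f x}"
        have W: "open W"
          unfolding W_def by (intro open_Diff V compact_imp_closed compact_level testD(1)[OF f])
        have "V - U \<subseteq> W" using f e by (force simp: W_def test_def)
        then have "outer (V - U) \<le> content W" using outer_mono outer_open[OF W] by metis
        then have "ennreal (\<phi> f) + outer (V - U) \<le> ennreal (\<phi> f) + content W" by (rule add_left_mono)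
        also have "\<dots> = (SUP g\<in>test W. ennreal (\<phi> f) + ennreal (\<phi> g))"
          unfolding content_def by (rule ennreal_SUP_add_right) (use zero_test in blast)
        also have "\<dots> \<le> content V + ennreal e"
        proof (rule SUP_least)
          fix g assume g: "g \<in> test W"
          have t: "(\<lambda>x. cut e f x + g x) \<in> test V"
          proof -
            have "0 \<le> cut e f x + g x \<and> cut e f x + g x \<le> 1 \<and> (x \<notin> V \<longrightarrow> cut e f x + g x = 0)" for x
            proof (cases "e \<le> f x")
              case True
              then have "g x = 0" using testD(4)[OF g, of x] by (simp add: W_def)
              then show ?thesis using True e testD(2-4)[OF f, of x] by (auto simp: cut_def)
            next
              case False
              then have "cut e f x = 0" by (simp add: cut_def)
              then show ?thesis using testD(2-4)[OF g, of x] by (auto simp: W_def)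
            qed
            then show ?thesis
              using continuous_cut[OF testD(1)[OF f], of e] testD(1)[OF g]
              by (auto simp: test_def intro: continuous_on_add)
          qed
          have "\<phi> f + \<phi> g \<le> \<phi> (\<lambda>x. cut e f x + g x) + e"
            using le_cut[OF testD(1)[OF f], of e] add[OF continuous_cut[OF testD(1)[OF f]] testD(1)[OF g], of e]
            by simp
          then have "ennreal (\<phi> f) + ennreal (\<phi> g) \<le> ennreal (\<phi> (\<lambda>x. cut e f x + g x)) + ennreal e"
            using testD(5)[OF f] testD(5)[OF g] testD(5)[OF t] e
            by (simp add: ennreal_plus[symmetric] del: ennreal_plus)
          also have "\<dots> \<le> content V + ennreal e" by (intro add_right_mono le_content t)
          finally show "ennreal (\<phi> f) + ennreal (\<phi> g) \<le> content V + ennreal e" .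
        qed
        finally show "ennreal (\<phi> f) + outer (V - U) \<le> content V + ennreal e" .
      qed
    qed
    finally show ?thesis .
  qed
  have ge: "outer (U \<inter> A) + outer (- U \<inter> A) \<le> outer A" for A
  proof (subst (3) outer_def, rule INF_greatest)
    fix V assume "V \<in> {V. open V \<and> A \<subseteq> V}"
    then have V: "open V" "A \<subseteq> V" by auto
    have "outer (U \<inter> A) + outer (- U \<inter> A) \<le> outer (V \<inter> U) + outer (V - U)"
      using V by (intro add_mono outer_mono) auto
    also have "\<dots> \<le> content V" using le[OF V(1)] U V by (simp add: outer_open open_Int)
    finally show "outer (U \<inter> A) + outer (- U \<inter> A) \<le> content V" .
  qed
  have "subadditive UNIV outer"
    using outer_measure_space_outer ring_of_sets.countably_subadditive_subadditive[OF ring_of_sets_Pow, of UNIV outer]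
    by (simp add: outer_measure_space_def)
  then have "outer ((U \<inter> A) \<union> (- U \<inter> A)) \<le> outer (U \<inter> A) + outer (- U \<inter> A)" for A
    by (rule subadditiveD) auto
  moreover have "(U \<inter> A) \<union> (- U \<inter> A) = A" for A by auto
  ultimately have "outer (U \<inter> A) + outer (- U \<inter> A) = outer A" for A
    using ge[of A] by (metis antisym)
  then show ?thesis
    by (simp add: lambda_system_def Compl_eq_Diff_UNIV)
qed

definition riesz :: "'k measure" where
  "riesz = measure_of UNIV (sets borel) outer"

lemma measure_space_riesz: "measure_space UNIV (sets (borel :: 'k measure)) outer"
proof -
  have ms: "measure_space UNIV (lambda_system UNIV UNIV outer) outer"
    using sigma_algebra.caratheodory_lemma[OF sigma_algebra_Pow, of UNIV outer] outer_measure_space_outer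
    by simp
  then have "sigma_sets UNIV {U :: 'k set. open U} \<subseteq> lambda_system UNIV UNIV outer"
    using open_in_lambda_system by (intro sigma_algebra.sigma_sets_subset) (auto simp: measure_space_def)
  then show ?thesis
    using ms measure_down[of UNIV "lambda_system UNIV UNIV outer" outer "sets (borel :: 'k measure)"]
      sets.sigma_algebra_axioms[of "borel :: 'k measure"]
    by (simp add: sets_borel)
qed

lemma sets_riesz [simp]: "sets riesz = sets borel" and space_riesz [simp]: "space riesz = UNIV"
  using sets.sigma_algebra_axioms[of "borel :: 'k measure"]
  by (simp_all add: riesz_def sigma_algebra.sigma_sets_eq space_measure_of_conv)

lemma emeasure_riesz: "A \<in> sets borel \<Longrightarrow> emeasure riesz A = outer A"
  using measure_space_riesz
  by (intro emeasure_measure_of[OF riesz_def]) (auto simp: measure_space_def)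

lemma prob_space_riesz: "prob_space riesz"
  by (rule prob_spaceI) (simp add: emeasure_riesz outer_open content_UNIV)


lemma sum_finite:
  assumes "\<And>i. i \<in> I \<Longrightarrow> continuous_on UNIV (f i)"
  shows "\<phi> (\<lambda>x. \<Sum>i\<in>I. f i x) = (\<Sum>i\<in>I. \<phi> (f i))"
  using assms
proof (induction I rule: infinite_finite_induct)
  case (insert i I)
  then show ?case
    using add[of "f i" "\<lambda>x. \<Sum>i\<in>I. f i x"] by (auto intro: continuous_on_sum)
qed (simp_all add: const)

lemma integrable_riesz:
  assumes f: "continuous_on UNIV f" and B: "\<And>x. \<bar>f x\<bar> \<le> (B::real)"
  shows "integrable riesz f"
proof -
  interpret prob_space riesz by (rule prob_space_riesz)
  have "f \<in> borel_measurable riesz"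
    using borel_measurable_continuous_onI[OF f] by (simp add: measurable_cong_sets[OF sets_riesz refl])
  then show ?thesis
    using B by (intro integrable_const_bound[of _ B]) auto
qed

lemma measure_riesz: "open U \<Longrightarrow> ennreal (measure riesz U) = content U"
proof -
  interpret prob_space riesz by (rule prob_space_riesz)
  show "open U \<Longrightarrow> ennreal (measure riesz U) = content U"
    by (simp add: emeasure_eq_measure[symmetric] emeasure_riesz outer_open)
qed

text \<open>
  The layer cake argument with N layers: N times the k-th layer is a test function for {f > k / N}
  and dominates the indicator function of {f > (k + 1) / N}. Summed over k,
  the two bounds differ by a telescoping sum of size at most 1 / N.
\<close>

lemma functional_le_integral_unit:
  assumes f: "continuous_on UNIV f" and f01: "\<And>x. 0 \<le> f x" "\<And>x. f x \<le> 1"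
  shows "\<phi> f \<le> integral\<^sup>L riesz f"
proof -
  interpret prob_space riesz by (rule prob_space_riesz)
  have bound: "\<phi> f \<le> integral\<^sup>L riesz f + inverse (real (Suc n))" for n
  proof -
    define N where "N = real (Suc n)"
    have N: "0 < N" by (simp add: N_def)
    define layer where "layer k x = min (f x) (real (Suc k) / N) - min (f x) (real k / N)" for k x
    define m where "m k = measure riesz {x. real k / N < f x}" for k
    have openf: "open {x. c < f x}" for c :: real
      using f by (intro open_Collect_less continuous_intros)
    have cl: "continuous_on UNIV (layer k)" for k
      unfolding layer_def by (intro continuous_intros f)
    have step: "real (Suc k) / N = real k / N + 1 / N" for k by (simp add: add_divide_distrib)
    have "0 < 1 / N" using N by simp
    then have l0: "0 \<le> layer k x" and l1: "layer k x \<le> 1 / N" for k x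
      unfolding layer_def step by linarith+
    have eq: "f = (\<lambda>x. \<Sum>k<Suc n. layer k x)"
    proof
      fix x
      have "(\<Sum>k<Suc n. layer k x) = min (f x) (real (Suc n) / N) - min (f x) 0"
        unfolding layer_def
        using sum_lessThan_telescope[of "\<lambda>k. min (f x) (real k / N)" "Suc n"] by simp
      also have "\<dots> = f x" using f01[of x] N by (auto simp: N_def min_def)
      finally show "f x = (\<Sum>k<Suc n. layer k x)" by simp
    qed
    have upper: "N * \<phi> (layer k) \<le> m k" for k
    proof -
      have "(\<lambda>x. N * layer k x) \<in> test {x. real k / N < f x}"
        using l0[of k] l1[of k] N
        by (auto simp: test_def field_simps intro!: continuous_intros cl) (auto simp: layer_def min_def field_simps)
      from le_content[OF this] have "ennreal (N * \<phi> (layer k)) \<le> ennreal (m k)"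
        unfolding m_def measure_riesz[OF openf] by (simp add: scale cl)
      then show ?thesis by (simp add: m_def)
    qed
    have il: "integrable riesz (layer k)" for k
      using l0 l1 by (intro integrable_riesz[of _ "1/N"] cl) (simp add: abs_of_nonneg)
    have lower: "m (Suc k) \<le> N * integral\<^sup>L riesz (layer k)" for k
    proof -
      let ?A = "{x. real (Suc k) / N < f x}"
      have A: "?A \<in> sets riesz" using openf by simp
      have "integral\<^sup>L riesz (\<lambda>x. (1/N) * indicator ?A x) \<le> integral\<^sup>L riesz (layer k)"
      proof (rule integral_mono)
        show "integrable riesz (\<lambda>x. 1 / N * indicat_real ?A x)"
          using A by (intro integrable_mult_right integrable_real_indicator) (simp_all add: less_top[symmetric])
        show "(1/N) * indicator ?A x \<le> layer k x" for x
        proof (cases "x \<in> ?A")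
          case True
          then have "layer k x = 1 / N" using \<open>0 < 1 / N\<close> unfolding layer_def step mem_Collect_eq by linarith
          then show ?thesis using True by simp
        qed (use l0 in auto)
      qed (rule il)
      also have "integral\<^sup>L riesz (\<lambda>x. (1/N) * indicator ?A x) = (1/N) * m (Suc k)"
        using A by (simp add: m_def)
      finally show ?thesis using N by (simp add: field_simps)
    qed
    have "N * \<phi> f = (\<Sum>k<Suc n. N * \<phi> (layer k))"
      by (subst eq) (simp only: sum_finite[OF cl] sum_distrib_left)
    also have "\<dots> \<le> (\<Sum>k<Suc n. m k)" by (intro sum_mono upper)
    also have "\<dots> = (\<Sum>k<Suc n. m (Suc k)) + (m 0 - m (Suc n))"
      using sum_lessThan_telescope'[of m "Suc n"] by (simp add: sum_subtractf)
    also have "\<dots> \<le> (\<Sum>k<Suc n. m (Suc k)) + 1"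
    proof -
      have "m 0 \<le> 1" "0 \<le> m (Suc n)" by (auto simp: m_def)
      then show ?thesis by linarith
    qed
    also have "\<dots> \<le> (\<Sum>k<Suc n. N * integral\<^sup>L riesz (layer k)) + 1"
      by (intro add_right_mono sum_mono lower)
    also have "(\<Sum>k<Suc n. N * integral\<^sup>L riesz (layer k)) = N * integral\<^sup>L riesz f"
      by (subst eq) (simp only: Bochner_Integration.integral_sum[OF il] sum_distrib_left)
    finally have "\<phi> f \<le> integral\<^sup>L riesz f + 1 / N" using N by (simp add: field_simps)
    then show ?thesis by (simp add: N_def inverse_eq_divide)
  qed
  have "(\<lambda>n. integral\<^sup>L riesz f + inverse (real (Suc n))) \<longlonglongrightarrow> integral\<^sup>L riesz f + 0"
    by (intro tendsto_intros LIMSEQ_inverse_real_of_nat)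
  then show ?thesis
    using bound by (intro LIMSEQ_le_const[of _ "integral\<^sup>L riesz f"]) auto
qed

text \<open>
  Reduction to values in the unit interval by the affine map t \<mapsto> (t + B) / (2 B).
\<close>

lemma functional_le_integral:
  assumes f: "continuous_on UNIV f"
  shows "\<phi> f \<le> integral\<^sup>L riesz f"
proof -
  interpret prob_space riesz by (rule prob_space_riesz)
  obtain B where B: "0 < B" "\<And>x. \<bar>f x\<bar> \<le> B" using continuous_bounded[OF compact_space_UNIV f] by blast
  let ?g = "\<lambda>x. inverse (2 * B) * (f x + B)"
  have fB: "continuous_on UNIV (\<lambda>x. f x + B)" by (intro continuous_intros f)
  have "0 \<le> ?g x" "?g x \<le> 1" for x
    using B(1) B(2)[of x] by (auto simp: field_simps abs_le_iff)
  then have "\<phi> ?g \<le> integral\<^sup>L riesz ?g"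
    by (intro functional_le_integral_unit continuous_intros f) auto
  moreover have "\<phi> ?g = inverse (2 * B) * (\<phi> f + B)"
    using scale[OF fB, of "inverse (2 * B)"] add[OF f, of "\<lambda>_. B"] const[of B] by (simp del: inverse_mult_distrib)
  moreover have "integral\<^sup>L riesz ?g = inverse (2 * B) * (integral\<^sup>L riesz f + B)"
    using integrable_riesz[OF f B(2)] prob_space[unfolded space_riesz] by simp
  ultimately show ?thesis using B(1) by (simp add: field_simps)
qed

text \<open>
  The reverse inequality is the previous one for - f.
\<close>

theorem integral_riesz:
  assumes f: "continuous_on UNIV f"
  shows "integral\<^sup>L riesz f = \<phi> f"
proof (rule antisym)
  show "\<phi> f \<le> integral\<^sup>L riesz f" by (rule functional_le_integral[OF f])
  have "\<phi> (\<lambda>x. - 1 * f x) \<le> integral\<^sup>L riesz (\<lambda>x. - 1 * f x)"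
    by (rule functional_le_integral) (intro continuous_intros f)
  then show "integral\<^sup>L riesz f \<le> \<phi> f" using scale[OF f, of "- 1"] by simp
qed

text \<open>
  Outer regularity holds by construction; inner regularity follows by taking complements, closed
  sets being compact.
\<close>

theorem regular_riesz: "regular_borel_probability riesz"
  unfolding regular_borel_probability_def
proof (intro conjI ballI)
  interpret prob_space riesz by (rule prob_space_riesz)
  fix A :: "'k set" assume A: "A \<in> sets borel"
  show "emeasure riesz A = (INF U\<in>{U. A \<subseteq> U \<and> open U}. emeasure riesz U)"
    using A by (auto simp: emeasure_riesz outer_def[of A] outer_open intro!: arg_cong[where f=Inf] image_cong)
  show "emeasure riesz A = (SUP C\<in>{C. C \<subseteq> A \<and> compact C}. emeasure riesz C)"
  proof (rule antisym)
    show "(SUP C\<in>{C. C \<subseteq> A \<and> compact C}. emeasure riesz C) \<le> emeasure riesz A"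
      using A by (intro SUP_least emeasure_mono) auto
    show "emeasure riesz A \<le> (SUP C\<in>{C. C \<subseteq> A \<and> compact C}. emeasure riesz C)" (is "_ \<le> ?S")
    proof (rule ennreal_le_epsilon)
      fix e :: real assume e: "0 < e"
      obtain U where U: "open U" "- A \<subseteq> U" "content U \<le> outer (- A) + ennreal e"
        by (rule outer_approx[OF e])
      have C: "compact (- U)" "- U \<subseteq> A"
        using closed_Int_compact[OF _ compact_space_UNIV, of "- U"] U by auto
      have compl: "emeasure riesz B + emeasure riesz (- B) = 1" if "B \<in> sets borel" for B
        using plus_emeasure[of B riesz "- B"] that emeasure_space_1
        by (simp add: Compl_eq_Diff_UNIV[symmetric] Compl_partition)
      have nA: "- A \<in> sets borel" using A by simp
      have "emeasure riesz (- A) + emeasure riesz A = emeasure riesz U + emeasure riesz (- U)"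
        using compl[OF A] compl[of U] U(1) by (simp add: add.commute)
      also have "\<dots> \<le> (outer (- A) + ennreal e) + ?S"
        using U C by (intro add_mono SUP_upper) (auto simp: emeasure_riesz outer_open)
      also have "\<dots> = emeasure riesz (- A) + (?S + ennreal e)"
        using nA by (simp add: emeasure_riesz ac_simps)
      finally show "emeasure riesz A \<le> ?S + ennreal e"
        by (subst (asm) ennreal_add_left_cancel_le) simp
    qed
  qed
qed (simp_all add: prob_space_riesz)

end

text \<open>
  If C is compact and U \<supseteq> C is open, a Urysohn function between their indicator functions gives
  \<mu> C \<le> \<nu> U; regularity of both measures then gives \<mu> \<le> \<nu> on all Borel sets.
\<close>

lemma regular_borel_probability_eqI:
  fixes \<mu> \<nu> :: "'k::t2_space measure"
  assumes comp: "compact (UNIV :: 'k set)"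
    and mu: "regular_borel_probability \<mu>" and nu: "regular_borel_probability \<nu>"
    and eq: "\<And>f :: 'k \<Rightarrow> real. continuous_on UNIV f \<Longrightarrow> integral\<^sup>L \<mu> f = integral\<^sup>L \<nu> f"
  shows "\<mu> = \<nu>"
proof -
  have le: "emeasure \<mu> A \<le> emeasure \<nu> A"
    if mu: "regular_borel_probability \<mu>" and nu: "regular_borel_probability \<nu>"
      and eq: "\<And>f :: 'k \<Rightarrow> real. continuous_on UNIV f \<Longrightarrow> integral\<^sup>L \<mu> f = integral\<^sup>L \<nu> f"
      and A: "A \<in> sets borel" for A and \<mu> \<nu> :: "'k measure"
  proof -
    interpret M: prob_space \<mu> using mu by (simp add: regular_borel_probability_def)
    interpret N: prob_space \<nu> using nu by (simp add: regular_borel_probability_def)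
    have sets [measurable_cong, simp]: "sets \<mu> = sets borel" "sets \<nu> = sets borel"
      using mu nu by (auto simp: regular_borel_probability_def)
    have CU: "emeasure \<mu> C \<le> emeasure \<nu> U" if K: "compact C" and U: "open U" and CU: "C \<subseteq> U" for C U
    proof -
      have C: "closed C" using K by (rule compact_imp_closed)
      obtain g :: "'k \<Rightarrow> real" where g: "continuous_on UNIV g" "\<And>x. 0 \<le> g x" "\<And>x. g x \<le> 1"
        "\<And>x. x \<in> C \<Longrightarrow> g x = 1" "\<And>x. x \<notin> U \<Longrightarrow> g x = 0"
        using compact_Urysohn[OF comp C U CU] by metis
      have [measurable]: "g \<in> borel_measurable borel" by (rule borel_measurable_continuous_onI[OF g(1)])
      have gi: "integrable \<mu> g" "integrable \<nu> g"
        using g by (auto intro!: M.integrable_const_bound[of _ 1] N.integrable_const_bound[of _ 1] simp: abs_of_nonneg)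
      have "measure \<mu> C = integral\<^sup>L \<mu> (indicator C)" using C by simp
      also have "\<dots> \<le> integral\<^sup>L \<mu> g"
        using C g by (intro integral_mono gi integrable_real_indicator)
          (auto simp: indicator_def less_top[symmetric])
      also have "\<dots> = integral\<^sup>L \<nu> g" by (rule eq[OF g(1)])
      also have "\<dots> \<le> integral\<^sup>L \<nu> (indicator U)"
        using U g by (intro integral_mono gi integrable_real_indicator)
          (auto simp: indicator_def less_top[symmetric])
      also have "\<dots> = measure \<nu> U" using U by simp
      finally show ?thesis by (simp add: M.emeasure_eq_measure N.emeasure_eq_measure)
    qed
    have "emeasure \<mu> A = (SUP C\<in>{C. C \<subseteq> A \<and> compact C}. emeasure \<mu> C)"
      using mu A by (simp add: regular_borel_probability_def)
    also have "\<dots> \<le> (INF U\<in>{U. A \<subseteq> U \<and> open U}. emeasure \<nu> U)"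
      using CU by (intro SUP_least INF_greatest) blast
    also have "\<dots> = emeasure \<nu> A"
      using nu A unfolding regular_borel_probability_def by metis
    finally show ?thesis .
  qed
  show ?thesis
    using le[OF mu nu eq] le[OF nu mu] eq mu nu
    by (intro measure_eqI antisym) (auto simp: regular_borel_probability_def)
qed

section \<open>Total boundedness of convex hulls in the mean\<close>

text \<open>
  If no finite net exists, points can be chosen one after the other, each unrelated to all earlier
  ones.
\<close>

lemma finite_net:
  assumes "\<And>u :: nat \<Rightarrow> 's. \<exists>i j. i < j \<and> Q (u j) (u i)"
  shows "\<exists>S0. finite S0 \<and> (\<forall>s. \<exists>t\<in>S0. Q s t)"
proof (rule ccontr)
  assume "\<not> ?thesis"
  then obtain c where c: "\<And>S0 t. finite S0 \<Longrightarrow> t \<in> S0 \<Longrightarrow> \<not> Q (c S0) t" by metis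
  define U where "U = rec_nat {} (\<lambda>_ S. insert (c S) S)"
  have U: "U 0 = {}" "U (Suc n) = insert (c (U n)) (U n)" for n by (simp_all add: U_def)
  have fin: "finite (U n)" for n by (induction n) (simp_all add: U)
  have mem: "c (U i) \<in> U n" if "i < n" for i n
    using that by (induction n) (auto simp: U less_Suc_eq)
  show False using assms[of "\<lambda>n. c (U n)"] c[OF fin mem] by blast
qed

lemma L1_Cauchy_of_pointwise_convergent:
  fixes F :: "nat \<Rightarrow> 'a \<Rightarrow> real"
  assumes M: "prob_space M" and meas: "\<And>n. F n \<in> borel_measurable M"
    and bound: "\<And>n x. \<bar>F n x\<bar> \<le> B" and lim: "\<And>x. (\<lambda>n. F n x) \<longlonglongrightarrow> l x" and e: "0 < e"
  shows "\<exists>N. \<forall>i\<ge>N. \<forall>j\<ge>N. (\<integral>x. \<bar>F i x - F j x\<bar> \<partial>M) < e"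
proof -
  interpret prob_space M by (rule M)
  have l: "l \<in> borel_measurable M" by (rule borel_measurable_LIMSEQ_real[OF lim meas])
  have lB: "\<bar>l x\<bar> \<le> B" for x
    using tendsto_rabs[OF lim] by (rule LIMSEQ_le_const2) (use bound in auto)
  have iF: "integrable M (F n)" for n
    using bound meas by (intro integrable_const_bound[of _ B]) auto
  have il: "integrable M l"
    using lB l by (intro integrable_const_bound[of _ B]) auto
  have bd: "\<bar>F n x - l x\<bar> \<le> 2 * B" for n x using bound[of n x] lB[of x] by linarith
  have "(\<lambda>n. \<integral>x. \<bar>F n x - l x\<bar> \<partial>M) \<longlonglongrightarrow> (\<integral>x. 0 \<partial>M)"
  proof (rule integral_dominated_convergence[where w="\<lambda>_. 2 * B"])
    have "(\<lambda>n. \<bar>F n x - l x\<bar>) \<longlonglongrightarrow> \<bar>l x - l x\<bar>" for x by (intro tendsto_intros lim)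
    then show "AE x in M. (\<lambda>n. \<bar>F n x - l x\<bar>) \<longlonglongrightarrow> 0" by simp
  qed (use meas l bd in auto)
  then have "(\<lambda>n. \<integral>x. \<bar>F n x - l x\<bar> \<partial>M) \<longlonglongrightarrow> 0" by simp
  then have "eventually (\<lambda>n. (\<integral>x. \<bar>F n x - l x\<bar> \<partial>M) < e / 2) sequentially"
    using e by (intro order_tendstoD(2)[of _ 0]) auto
  then obtain N where N: "\<And>n. n \<ge> N \<Longrightarrow> (\<integral>x. \<bar>F n x - l x\<bar> \<partial>M) < e / 2"
    by (auto simp: eventually_sequentially)
  have "(\<integral>x. \<bar>F i x - F j x\<bar> \<partial>M) < e" if "i \<ge> N" "j \<ge> N" for i j
  proof -
    have "(\<integral>x. \<bar>F i x - F j x\<bar> \<partial>M) \<le> (\<integral>x. \<bar>F i x - l x\<bar> + \<bar>F j x - l x\<bar> \<partial>M)"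
      using iF il by (intro integral_mono integrable_abs Bochner_Integration.integrable_add
          Bochner_Integration.integrable_diff) auto
    also have "\<dots> = (\<integral>x. \<bar>F i x - l x\<bar> \<partial>M) + (\<integral>x. \<bar>F j x - l x\<bar> \<partial>M)"
      using iF il by (intro Bochner_Integration.integral_add integrable_abs Bochner_Integration.integrable_diff)
    finally show ?thesis using N[OF that(1)] N[OF that(2)] by linarith
  qed
  then show ?thesis by blast
qed

text \<open>
  The sequential compactness that defines tameness, for an indexed family of real functions.
\<close>

definition seq_compact_family :: "('i \<Rightarrow> 'a \<Rightarrow> real) \<Rightarrow> bool" where
  "seq_compact_family F \<longleftrightarrow>
     (\<forall>u :: nat \<Rightarrow> 'i. \<exists>r l. strict_mono r \<and> (\<forall>x. (\<lambda>n. F (u (r n)) x) \<longlonglongrightarrow> l x))"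

lemma seq_compact_family_comp:
  "seq_compact_family F \<Longrightarrow> seq_compact_family (\<lambda>s c. F s (\<theta> c))"
  unfolding seq_compact_family_def by (meson)

text \<open>
  One net serves two measures, so that later a single convex combination can be used for both.
\<close>

lemma L1_finite_net2:
  fixes F :: "'i \<Rightarrow> 'a \<Rightarrow> real"
  assumes M: "prob_space M" and M': "prob_space M'"
    and meas: "\<And>s. F s \<in> borel_measurable M" "\<And>s. F s \<in> borel_measurable M'"
    and bound: "\<And>s x. \<bar>F s x\<bar> \<le> B" and seq: "seq_compact_family F" and e: "0 < e"
  shows "\<exists>S0. finite S0 \<and> (\<forall>s. \<exists>t\<in>S0. (\<integral>x. \<bar>F s x - F t x\<bar> \<partial>M) < e \<and> (\<integral>x. \<bar>F s x - F t x\<bar> \<partial>M') < e)"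
proof (rule finite_net)
  fix u :: "nat \<Rightarrow> 'i"
  obtain r l where r: "strict_mono r" and l: "\<And>x. (\<lambda>n. F (u (r n)) x) \<longlonglongrightarrow> l x"
    using seq unfolding seq_compact_family_def by meson
  obtain N where N: "\<And>i j. i \<ge> N \<Longrightarrow> j \<ge> N \<Longrightarrow> (\<integral>x. \<bar>F (u (r i)) x - F (u (r j)) x\<bar> \<partial>M) < e"
    using L1_Cauchy_of_pointwise_convergent[OF M meas(1) bound l e] by auto
  obtain N' where N': "\<And>i j. i \<ge> N' \<Longrightarrow> j \<ge> N' \<Longrightarrow> (\<integral>x. \<bar>F (u (r i)) x - F (u (r j)) x\<bar> \<partial>M') < e"
    using L1_Cauchy_of_pointwise_convergent[OF M' meas(2) bound l e] by auto
  let ?i = "max N N'"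
  have "r ?i < r (Suc ?i)" using r by (simp add: strict_mono_Suc_iff)
  moreover have "(\<integral>x. \<bar>F (u (r (Suc ?i))) x - F (u (r ?i)) x\<bar> \<partial>M) < e"
    "(\<integral>x. \<bar>F (u (r (Suc ?i))) x - F (u (r ?i)) x\<bar> \<partial>M') < e"
    by (rule N N'; linarith)+
  ultimately show "\<exists>i j. i < j \<and> (\<integral>x. \<bar>F (u j) x - F (u i) x\<bar> \<partial>M) < e \<and> (\<integral>x. \<bar>F (u j) x - F (u i) x\<bar> \<partial>M') < e"
    by blast
qed

definition function_hull :: "('i \<Rightarrow> 'a \<Rightarrow> real) \<Rightarrow> ('a \<Rightarrow> real) set" where
  "function_hull F = {h. \<exists>S w. finite S \<and> (\<forall>s\<in>S. 0 \<le> w s) \<and> (\<Sum>s\<in>S. w s) = 1 \<and>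
     h = (\<lambda>x. \<Sum>s\<in>S. w s * F s x)}"

lemma function_hull_comp:
  "h \<in> function_hull F \<Longrightarrow> (\<lambda>c. h (\<theta> c)) \<in> function_hull (\<lambda>s c. F s (\<theta> c))"
  unfolding function_hull_def by blast

text \<open>
  Each member of the family is replaced by a nearby point of the net, and the weights of the members
  with the same replacement are added up.
\<close>

lemma function_hull_near_combination:
  fixes F :: "'i \<Rightarrow> 'a \<Rightarrow> real"
  assumes int: "\<And>s. integrable M (F s)"
    and S0: "finite S0" "\<And>s. \<exists>t\<in>S0. (\<integral>x. \<bar>F s x - F t x\<bar> \<partial>M) < e"
    and h: "h \<in> function_hull F"
  shows "\<exists>W. (\<forall>a\<in>S0. 0 \<le> W a \<and> W a \<le> 1) \<and> (\<integral>x. \<bar>h x - (\<Sum>a\<in>S0. W a * F a x)\<bar> \<partial>M) \<le> e"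
proof -
  obtain S w where S: "finite S" "\<And>s. s \<in> S \<Longrightarrow> 0 \<le> w s" "(\<Sum>s\<in>S. w s) = 1"
    and h_eq: "h = (\<lambda>x. \<Sum>s\<in>S. w s * F s x)"
    using h unfolding function_hull_def by auto
  obtain \<rho> where \<rho>: "\<And>s. \<rho> s \<in> S0" "\<And>s. (\<integral>x. \<bar>F s x - F (\<rho> s) x\<bar> \<partial>M) < e"
    using S0(2) by metis
  define W where "W a = (\<Sum>s\<in>{s\<in>S. \<rho> s = a}. w s)" for a
  have W0: "0 \<le> W a" for a unfolding W_def using S by (intro sum_nonneg) auto
  have "W a \<le> (\<Sum>s\<in>S. w s)" for a unfolding W_def using S by (intro sum_mono2) auto
  then have W1: "W a \<le> 1" for a using S(3) by simp
  have comb: "(\<Sum>a\<in>S0. W a * F a x) = (\<Sum>s\<in>S. w s * F (\<rho> s) x)" for x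
  proof -
    have "(\<Sum>a\<in>S0. W a * F a x) = (\<Sum>a\<in>S0. \<Sum>s\<in>{s\<in>S. \<rho> s = a}. w s * F (\<rho> s) x)"
      by (simp add: W_def sum_distrib_right)
    also have "\<dots> = (\<Sum>s\<in>S. w s * F (\<rho> s) x)"
      using S(1) S0(1) \<rho>(1) by (intro sum.group) auto
    finally show ?thesis .
  qed
  have id: "integrable M (\<lambda>x. \<bar>F s x - F (\<rho> s) x\<bar>)" for s
    by (intro integrable_abs Bochner_Integration.integrable_diff int)
  have "(\<integral>x. \<bar>h x - (\<Sum>a\<in>S0. W a * F a x)\<bar> \<partial>M) \<le> (\<integral>x. (\<Sum>s\<in>S. w s * \<bar>F s x - F (\<rho> s) x\<bar>) \<partial>M)"
  proof (rule integral_mono)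
    show "integrable M (\<lambda>x. \<bar>h x - (\<Sum>a\<in>S0. W a * F a x)\<bar>)"
      unfolding h_eq by (intro integrable_abs Bochner_Integration.integrable_diff
          Bochner_Integration.integrable_sum integrable_mult_right int)
    show "integrable M (\<lambda>x. \<Sum>s\<in>S. w s * \<bar>F s x - F (\<rho> s) x\<bar>)"
      by (intro Bochner_Integration.integrable_sum integrable_mult_right id)
    show "\<bar>h x - (\<Sum>a\<in>S0. W a * F a x)\<bar> \<le> (\<Sum>s\<in>S. w s * \<bar>F s x - F (\<rho> s) x\<bar>)" for x
    proof -
      have "h x - (\<Sum>a\<in>S0. W a * F a x) = (\<Sum>s\<in>S. w s * (F s x - F (\<rho> s) x))"
        by (simp add: h_eq comb sum_subtractf right_diff_distrib)
      also have "\<bar>\<dots>\<bar> \<le> (\<Sum>s\<in>S. \<bar>w s * (F s x - F (\<rho> s) x)\<bar>)" by (rule sum_abs)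
      also have "\<dots> = (\<Sum>s\<in>S. w s * \<bar>F s x - F (\<rho> s) x\<bar>)"
        using S(2) by (intro sum.cong) (auto simp: abs_mult)
      finally show ?thesis .
    qed
  qed
  also have "\<dots> = (\<Sum>s\<in>S. w s * (\<integral>x. \<bar>F s x - F (\<rho> s) x\<bar> \<partial>M))"
    by (subst Bochner_Integration.integral_sum) (auto intro!: integrable_mult_right id)
  also have "\<dots> \<le> (\<Sum>s\<in>S. w s * e)"
    using S(2) \<rho>(2) by (intro sum_mono mult_left_mono) (auto intro: less_imp_le)
  also have "\<dots> = e" using S(3) by (simp add: sum_distrib_right[symmetric])
  finally show ?thesis using W0 W1 by blast
qed

text \<open>
  Up to a small error each h n is a combination of the finitely many functions in a net, with
  weights in [0, 1]. After rounding the weights to multiples of 1 / N only finitely many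
  combinations remain, so two of the h n are close by the pigeonhole principle.
\<close>

lemma function_hull_totally_bounded:
  fixes F :: "'i \<Rightarrow> 'a \<Rightarrow> real"
  assumes M: "prob_space M" and meas: "\<And>s. F s \<in> borel_measurable M"
    and bound: "\<And>s x. \<bar>F s x\<bar> \<le> B" and seq: "seq_compact_family F" and e: "0 < e"
    and h: "\<And>n::nat. h n \<in> function_hull F"
  shows "\<exists>n m. n \<noteq> m \<and> (\<integral>x. \<bar>h n x - h m x\<bar> \<partial>M) < e"
proof -
  interpret prob_space M by (rule M)
  have int: "integrable M (F s)" for s
    using bound meas by (intro integrable_const_bound[of _ B]) auto
  have B0: "0 \<le> B" using bound[of undefined undefined] by linarith
  obtain S0 where S0: "finite S0" "\<And>s. \<exists>t\<in>S0. (\<integral>x. \<bar>F s x - F t x\<bar> \<partial>M) < e / 4"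
    using L1_finite_net2[OF M M meas meas bound seq, of "e / 4"] e by auto
  have "\<forall>n. \<exists>W. (\<forall>a\<in>S0. 0 \<le> W a \<and> W a \<le> 1) \<and>
      (\<integral>x. \<bar>h n x - (\<Sum>a\<in>S0. W a * F a x)\<bar> \<partial>M) \<le> e / 4"
    by (intro allI function_hull_near_combination[OF int S0 h])
  then obtain W where "\<forall>n. (\<forall>a\<in>S0. 0 \<le> W n a \<and> W n a \<le> 1) \<and>
      (\<integral>x. \<bar>h n x - (\<Sum>a\<in>S0. W n a * F a x)\<bar> \<partial>M) \<le> e / 4"
    by (rule choice[THEN exE])
  then have W: "\<And>n a. a \<in> S0 \<Longrightarrow> 0 \<le> W n a" "\<And>n a. a \<in> S0 \<Longrightarrow> W n a \<le> 1"
    and Wh: "\<And>n. (\<integral>x. \<bar>h n x - (\<Sum>a\<in>S0. W n a * F a x)\<bar> \<partial>M) \<le> e / 4"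
    by auto
  obtain N :: nat where N: "4 * (real (card S0) * B) / e < real N" using reals_Archimedean2 by blast
  then have Npos: "0 < real N" using B0 e by (smt (verit) divide_nonneg_pos mult_nonneg_nonneg of_nat_0_le_iff)
  \<comment> \<open>The weights in units of 1 / N, rounded down.\<close>
  define \<kappa> where "\<kappa> n = restrict (\<lambda>a. \<lfloor>W n a * real N\<rfloor>) S0" for n
  have "range \<kappa> \<subseteq> PiE S0 (\<lambda>_. {0..int N})"
  proof -
    have "0 \<le> \<lfloor>W n a * real N\<rfloor>" "\<lfloor>W n a * real N\<rfloor> \<le> int N" if "a \<in> S0" for n a
      using W[OF that, of n] Npos by (auto simp: floor_le_iff mult_left_le_one_le intro: le_less_trans[of _ "real N"])
    then show ?thesis by (auto simp: \<kappa>_def)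
  qed
  then have "finite (range \<kappa>)" by (rule finite_subset) (intro finite_PiE S0(1), simp)
  then have "\<not> inj \<kappa>" using finite_imageD infinite_UNIV_nat by blast
  then obtain n m where nm: "n \<noteq> m" "\<kappa> n = \<kappa> m" by (auto simp: inj_def)
  have close: "\<bar>W n a - W m a\<bar> \<le> 1 / real N" if "a \<in> S0" for a
  proof -
    have "\<lfloor>W n a * real N\<rfloor> = \<lfloor>W m a * real N\<rfloor>"
      using fun_cong[OF nm(2), of a] that by (simp add: \<kappa>_def)
    then have "\<bar>W n a * real N - W m a * real N\<bar> \<le> 1" by linarith
    then have "\<bar>W n a - W m a\<bar> * real N \<le> 1" using Npos by (simp add: left_diff_distrib[symmetric] abs_mult)
    then show ?thesis using Npos by (simp add: field_simps)
  qed
  let ?C = "\<lambda>n x. \<Sum>a\<in>S0. W n a * F a x"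
  have iC: "integrable M (?C k)" for k
    by (intro Bochner_Integration.integrable_sum integrable_mult_right int)
  have ih: "integrable M (h k)" for k
    using h[of k] unfolding function_hull_def
    by (auto intro!: Bochner_Integration.integrable_sum integrable_mult_right int)
  have Cnm: "\<bar>?C n x - ?C m x\<bar> \<le> e / 4" for x
  proof -
    have "\<bar>?C n x - ?C m x\<bar> = \<bar>\<Sum>a\<in>S0. (W n a - W m a) * F a x\<bar>"
      by (simp add: sum_subtractf left_diff_distrib)
    also have "\<dots> \<le> (\<Sum>a\<in>S0. \<bar>(W n a - W m a) * F a x\<bar>)" by (rule sum_abs)
    also have "\<dots> \<le> (\<Sum>a\<in>S0. 1 / real N * B)"
      unfolding abs_mult using close bound B0 Npos by (intro sum_mono mult_mono) auto
    also have "\<dots> \<le> e / 4" using N Npos e by (simp add: field_simps)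
    finally show ?thesis .
  qed
  have "(\<integral>x. \<bar>h n x - h m x\<bar> \<partial>M) \<le> (\<integral>x. \<bar>h n x - ?C n x\<bar> + \<bar>h m x - ?C m x\<bar> + e / 4 \<partial>M)"
  proof (rule integral_mono)
    show "\<bar>h n x - h m x\<bar> \<le> \<bar>h n x - ?C n x\<bar> + \<bar>h m x - ?C m x\<bar> + e / 4" for x
      using Cnm[of x] by linarith
  qed (use ih iC in \<open>auto intro!: integrable_abs Bochner_Integration.integrable_add Bochner_Integration.integrable_diff simp del: integrable_abs_iff\<close>)
  also have "\<dots> = (\<integral>x. \<bar>h n x - ?C n x\<bar> \<partial>M) + (\<integral>x. \<bar>h m x - ?C m x\<bar> \<partial>M) + e / 4"
    using ih iC by (simp add: prob_space)
  also have "\<dots> < e" using Wh[of n] Wh[of m] e by linarith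
  finally show ?thesis using nm(1) by blast
qed

section \<open>Independent sequences over the Cantor space\<close>

definition initial_word :: "(nat \<Rightarrow> bool) \<Rightarrow> nat \<Rightarrow> bool list" where
  "initial_word c n = map c [0..<n]"

lemma length_initial_word [simp]: "length (initial_word c n) = n"
  by (simp add: initial_word_def)

lemma initial_word_Suc: "initial_word c (Suc n) = initial_word c n @ [c n]"
  by (simp add: initial_word_def)

text \<open>
  The fair coin measure on the Cantor space.
\<close>

definition coin :: "(nat \<Rightarrow> bool) measure" where
  "coin = (\<Pi>\<^sub>M i\<in>UNIV. measure_pmf (bernoulli_pmf (1/2)))"

lemma product_prob_space_coin: "product_prob_space (\<lambda>i::nat. measure_pmf (bernoulli_pmf (1/2)))"
  by (rule product_prob_spaceI) (rule prob_space_measure_pmf)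

lemma prob_space_coin: "prob_space coin"
  unfolding coin_def by (intro prob_space_PiM prob_space_measure_pmf)

lemma space_coin [simp]: "space coin = UNIV"
  by (auto simp: coin_def space_PiM)

lemma measurable_coordinate [measurable]: "(\<lambda>c. c i) \<in> measurable coin (count_space UNIV)"
proof -
  have "(\<lambda>c. c i) \<in> measurable coin (measure_pmf (bernoulli_pmf (1/2)))"
    unfolding coin_def by (rule measurable_component_singleton) simp
  then show ?thesis by (simp cong: measurable_cong_sets)
qed

lemma measurable_initial_word: "(\<lambda>c. initial_word c n) \<in> measurable coin (count_space UNIV)"
proof -
  have "(\<lambda>c. initial_word c n) -` {\<sigma>} \<inter> space coin \<in> sets coin" for \<sigma>
  proof -
    have "initial_word c n = \<sigma> \<longleftrightarrow> length \<sigma> = n \<and> (\<forall>i\<in>{..<n}. c i = \<sigma> ! i)" for c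
      by (auto simp: initial_word_def intro!: nth_equalityI)
    then have "(\<lambda>c. initial_word c n) -` {\<sigma>} \<inter> space coin =
        {c\<in>space coin. length \<sigma> = n \<and> (\<forall>i\<in>{..<n}. c i = \<sigma> ! i)}"
      by auto
    also have "\<dots> \<in> sets coin" by measurable
    finally show ?thesis .
  qed
  then show ?thesis by (simp add: measurable_count_space_eq2_countable)
qed

lemma measure_coin_distinct_coordinates:
  assumes "n \<noteq> m"
  shows "measure coin {c. c n \<and> \<not> c m} = 1 / 4"
proof -
  interpret product_prob_space "\<lambda>i::nat. measure_pmf (bernoulli_pmf (1/2))" UNIV
    by (rule product_prob_space_coin)
  let ?X = "\<lambda>i. if i = n then {True} else {False}"
  have "{c \<in> space coin. \<forall>i\<in>{n, m}. c i \<in> ?X i} = {c. c n \<and> \<not> c m}"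
    using assms by auto
  moreover have "emeasure coin {c \<in> space coin. \<forall>i\<in>{n, m}. c i \<in> ?X i} =
      (\<Prod>i\<in>{n, m}. emeasure (measure_pmf (bernoulli_pmf (1/2))) (?X i))"
    unfolding coin_def by (rule emeasure_PiM_Collect) auto
  moreover have "(\<Prod>i\<in>{n, m}. emeasure (measure_pmf (bernoulli_pmf (1/2))) (?X i)) = ennreal (1/2) * ennreal (1/2)"
    using assms by (simp add: emeasure_pmf_single)
  ultimately have "emeasure coin {c. c n \<and> \<not> c m} = ennreal (1/4)"
    by (simp add: ennreal_mult[symmetric] del: ennreal_half)
  then show ?thesis by (simp add: measure_def)
qed

text \<open>
  The property that drives the Cantor scheme: the levels a and b are fixed in advance, while the
  function may depend on the open sets.
\<close>

definition splits_open_sets :: "('k::topological_space \<Rightarrow> real) set \<Rightarrow> real \<Rightarrow> real \<Rightarrow> bool" where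
  "splits_open_sets B a b \<longleftrightarrow> (\<forall>\<U>. finite \<U> \<longrightarrow> (\<forall>U\<in>\<U>. open U \<and> U \<noteq> {}) \<longrightarrow>
     (\<exists>h\<in>B. \<forall>U\<in>\<U>. (\<exists>x\<in>U. h x < a) \<and> (\<exists>x\<in>U. b < h x)))"

text \<open>
  At level n, one application of the splitting property to the 2^n sets U n \<sigma> gives h n, and
  inside U n \<sigma> two open sets of small diameter are chosen, one where h n > b and one where
  h n < a. The closures are nested to make compactness applicable along each branch.
\<close>

lemma Cantor_scheme:
  fixes B :: "('k::t2_space \<Rightarrow> real) set" and a b :: real and d :: "'k \<Rightarrow> 'k \<Rightarrow> real"
  assumes d: "Metric_space UNIV d" "Metric_space.mtopology UNIV d = euclidean"
    and cont: "\<forall>h\<in>B. continuous_on UNIV h" and split: "splits_open_sets B a b"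
  shows "\<exists>h U. (\<forall>n::nat. h n \<in> B) \<and> (\<forall>\<sigma>::bool list. U (length \<sigma>) \<sigma> \<noteq> {}) \<and>
    (\<forall>\<sigma> i. closure (U (Suc (length \<sigma>)) (\<sigma> @ [i])) \<subseteq> U (length \<sigma>) \<sigma>) \<and>
    (\<forall>\<sigma>. \<forall>x\<in>U (Suc (length \<sigma>)) (\<sigma> @ [True]). b < h (length \<sigma>) x) \<and>
    (\<forall>\<sigma>. \<forall>x\<in>U (Suc (length \<sigma>)) (\<sigma> @ [False]). h (length \<sigma>) x < a) \<and>
    (\<forall>n \<sigma>. length \<sigma> = Suc n \<longrightarrow> (\<forall>x\<in>U (Suc n) \<sigma>. \<forall>y\<in>U (Suc n) \<sigma>. d x y < 1 / real (Suc n)))"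
proof -
  interpret Metric_space UNIV d by (rule d)
  have shrink: "\<exists>V. open V \<and> V \<noteq> {} \<and> closure V \<subseteq> W \<and> (\<forall>x\<in>V. \<forall>y\<in>V. d x y < e)"
    if W: "open W" "W \<noteq> {}" and e: "0 < e" for W and e :: real
  proof -
    obtain x where x: "x \<in> W" using W by auto
    have "openin mtopology W" using W d(2) by simp
    then obtain r where r: "0 < r" "mcball x r \<subseteq> W" using x unfolding openin_mtopology_mcball by blast
    let ?V = "mball x (min r (e / 2))"
    have "closedin mtopology (mcball x r)" by (rule closedin_mcball)
    then have "closed (mcball x r)" unfolding d(2) by (simp only: closed_closedin)
    then have "closure ?V \<subseteq> mcball x r" by (rule closure_minimal[rotated]) auto
    moreover have "openin mtopology ?V" by (rule openin_mball)
    then have "open ?V" by (simp add: d(2))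
    moreover have "x \<in> ?V" using r e by simp
    moreover have "d y z < e" if "y \<in> ?V" "z \<in> ?V" for y z
      using that triangle[of y x z] commute[of x y] by auto
    ultimately show ?thesis using r by (intro exI[of _ ?V]) blast
  qed
  \<comment> \<open>A state of the construction: the function chosen last and the sets attached to the words of
    length n. In state 0 the function is a dummy.\<close>
  define P where "P n p \<longleftrightarrow> (\<forall>\<sigma>. length \<sigma> = n \<longrightarrow> open (snd p \<sigma>) \<and> snd p \<sigma> \<noteq> {})"
    for n and p :: "('k \<Rightarrow> real) \<times> (bool list \<Rightarrow> 'k set)"
  define Q where "Q n p q \<longleftrightarrow> fst q \<in> B \<and> (\<forall>\<sigma> i. length \<sigma> = n \<longrightarrow>
      closure (snd q (\<sigma> @ [i])) \<subseteq> snd p \<sigma> \<inter> {x. if i then b < fst q x else fst q x < a} \<and>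
      (\<forall>x\<in>snd q (\<sigma> @ [i]). \<forall>y\<in>snd q (\<sigma> @ [i]). d x y < 1 / real (Suc n)))"
    for n and p q :: "('k \<Rightarrow> real) \<times> (bool list \<Rightarrow> 'k set)"
  have "\<exists>f. \<forall>n. P n (f n) \<and> Q n (f n) (f (Suc n))"
  proof (rule dependent_nat_choice)
    show "\<exists>p. P 0 p" by (intro exI[of _ "(\<lambda>_. 0, \<lambda>_. UNIV)"]) (simp add: P_def)
    fix p n assume p: "P n p"
    have "finite (snd p ` {\<sigma>. set \<sigma> \<subseteq> UNIV \<and> length \<sigma> = n})"
      by (intro finite_imageI finite_lists_length_eq) simp
    then obtain h where h: "h \<in> B"
      and sp: "\<And>\<sigma>. length \<sigma> = n \<Longrightarrow> (\<exists>x\<in>snd p \<sigma>. h x < a) \<and> (\<exists>x\<in>snd p \<sigma>. b < h x)"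
      using split[unfolded splits_open_sets_def, rule_format, of "snd p ` {\<sigma>. set \<sigma> \<subseteq> UNIV \<and> length \<sigma> = n}"] p
      by (auto simp: P_def)
    let ?W = "\<lambda>\<sigma> i. snd p \<sigma> \<inter> {x. if i then b < h x else h x < a}"
    have W: "open (?W \<sigma> i) \<and> ?W \<sigma> i \<noteq> {}" if "length \<sigma> = n" for \<sigma> i
    proof -
      have "open {x. b < h x}" "open {x. h x < a}"
        using bspec[OF cont h] by (intro open_Collect_less continuous_intros; assumption)+
      then show ?thesis using sp[OF that] p that by (cases i) (auto simp: P_def)
    qed
    define R where "R \<sigma> i V \<longleftrightarrow> open V \<and> V \<noteq> {} \<and> closure V \<subseteq> ?W \<sigma> i \<and>
        (\<forall>x\<in>V. \<forall>y\<in>V. d x y < 1 / real (Suc n))" for \<sigma> i V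
    define V where "V \<sigma> i = (SOME V. R \<sigma> i V)" for \<sigma> i
    have V: "R \<sigma> i (V \<sigma> i)" if "length \<sigma> = n" for \<sigma> i
      unfolding V_def using W[OF that, of i] shrink[of "?W \<sigma> i" "1 / real (Suc n)"]
      by (intro someI_ex[of "R \<sigma> i"]) (simp add: R_def)
    define q where "q = (h, \<lambda>\<sigma>. V (butlast \<sigma>) (last \<sigma>))"
    have "P (Suc n) q" using V by (auto simp: P_def q_def R_def)
    moreover have "Q n p q" using V h unfolding Q_def q_def R_def fst_conv snd_conv butlast_snoc last_snoc by blast
    ultimately show "\<exists>q. P (Suc n) q \<and> Q n p q" by blast
  qed
  then obtain f where P: "\<And>n. P n (f n)" and Q: "\<And>n. Q n (f n) (f (Suc n))" by blast
  have last: "\<sigma> = butlast \<sigma> @ [last \<sigma>] \<and> length (butlast \<sigma>) = n" if "length \<sigma> = Suc n" for \<sigma> :: "bool list" and n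
    using that by (cases \<sigma> rule: rev_cases) auto
  have cl: "closure (snd (f (Suc (length \<sigma>))) (\<sigma> @ [i])) \<subseteq>
      snd (f (length \<sigma>)) \<sigma> \<inter> {x. if i then b < fst (f (Suc (length \<sigma>))) x else fst (f (Suc (length \<sigma>))) x < a}"
    for \<sigma> i using Q[of "length \<sigma>"] unfolding Q_def by blast
  show ?thesis
  proof (intro exI[of _ "\<lambda>n. fst (f (Suc n))"] exI[of _ "\<lambda>n. snd (f n)"] conjI allI impI ballI)
    fix n and \<sigma> :: "bool list" and x y
    assume "length \<sigma> = Suc n" "x \<in> snd (f (Suc n)) \<sigma>" "y \<in> snd (f (Suc n)) \<sigma>"
    then show "d x y < 1 / real (Suc n)" using Q[of n] last[of \<sigma> n] unfolding Q_def by metis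
  next
    fix \<sigma> :: "bool list"
    show "closure (snd (f (Suc (length \<sigma>))) (\<sigma> @ [i])) \<subseteq> snd (f (length \<sigma>)) \<sigma>" for i
      using cl[of \<sigma> i] by blast
    show "b < fst (f (Suc (length \<sigma>))) x" if "x \<in> snd (f (Suc (length \<sigma>))) (\<sigma> @ [True])" for x
      using cl[of \<sigma> True] that closure_subset by fastforce
    show "fst (f (Suc (length \<sigma>))) x < a" if "x \<in> snd (f (Suc (length \<sigma>))) (\<sigma> @ [False])" for x
      using cl[of \<sigma> False] that closure_subset by fastforce
    show "snd (f (length \<sigma>)) \<sigma> \<noteq> {}" using P[of "length \<sigma>"] by (simp add: P_def)
  next
    show "fst (f (Suc n)) \<in> B" for n using Q[of n] by (simp add: Q_def)
  qed
qed

text \<open>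
  \<theta> c is the point in which the branch of c ends. Since the diameters tend to 0, u \<circ> \<theta> is for
  continuous u the pointwise limit of functions of finitely many coordinates, hence measurable.
\<close>

lemma independent_sequence:
  fixes B :: "('k::t2_space \<Rightarrow> real) set" and a b :: real
  assumes comp: "compact (UNIV :: 'k set)" and metr: "metrizable_space (euclidean :: 'k topology)"
    and cont: "\<forall>h\<in>B. continuous_on UNIV h" and split: "splits_open_sets B a b"
  shows "\<exists>h \<theta>. (\<forall>n. h n \<in> B) \<and> (\<forall>n c. c n \<longrightarrow> b < h n (\<theta> c)) \<and> (\<forall>n c. \<not> c n \<longrightarrow> h n (\<theta> c) < a) \<and>
    (\<forall>u :: 'k \<Rightarrow> real. continuous_on UNIV u \<longrightarrow> (\<lambda>c. u (\<theta> c)) \<in> borel_measurable coin)"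
proof -
  obtain M d where "Metric_space M d" and eu: "euclidean = Metric_space.mtopology M (d :: 'k \<Rightarrow> 'k \<Rightarrow> real)"
    using metr unfolding metrizable_space_def by blast
  moreover have "M = UNIV"
    using Metric_space.topspace_mtopology[OF \<open>Metric_space M d\<close>] eu by (metis topspace_euclidean)
  ultimately have d: "Metric_space UNIV d" "Metric_space.mtopology UNIV d = euclidean" by auto
  interpret Metric_space UNIV d by (rule d)
  obtain h :: "nat \<Rightarrow> 'k \<Rightarrow> real" and U :: "nat \<Rightarrow> bool list \<Rightarrow> 'k set"
    where hB: "\<forall>n. h n \<in> B" and ne: "\<forall>\<sigma>. U (length \<sigma>) \<sigma> \<noteq> {}"
    and cl: "\<forall>\<sigma> i. closure (U (Suc (length \<sigma>)) (\<sigma> @ [i])) \<subseteq> U (length \<sigma>) \<sigma>"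
    and hT: "\<forall>\<sigma>. \<forall>x\<in>U (Suc (length \<sigma>)) (\<sigma> @ [True]). b < h (length \<sigma>) x"
    and hF: "\<forall>\<sigma>. \<forall>x\<in>U (Suc (length \<sigma>)) (\<sigma> @ [False]). h (length \<sigma>) x < a"
    and diam: "\<forall>n \<sigma>. length \<sigma> = Suc n \<longrightarrow>
      (\<forall>x\<in>U (Suc n) \<sigma>. \<forall>y\<in>U (Suc n) \<sigma>. d x y < 1 / real (Suc n))"
    using Cantor_scheme[OF d cont split] by (elim exE conjE) (rule that)
  let ?U = "\<lambda>c n. U n (initial_word c n)"
  have step: "closure (?U c (Suc n)) \<subseteq> ?U c n" for c n
    unfolding initial_word_Suc using cl[rule_format, of "initial_word c n"] by simp
  have "\<exists>x. \<forall>n. x \<in> ?U c n" for c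
  proof -
    have dec: "closure (?U c n) \<subseteq> closure (?U c m)" if "m \<le> n" for m n
      using that
    proof (induction rule: dec_induct)
      case (step k)
      then show ?case using \<open>closure (?U c (Suc k)) \<subseteq> ?U c k\<close> closure_subset[of "?U c k"] by blast
    qed simp
    have "UNIV \<inter> (\<Inter>n. closure (?U c n)) \<noteq> {}"
    proof (rule compact_imp_fip_image[OF comp])
      fix I :: "nat set" assume "finite I"
      then obtain N where "I \<subseteq> {..<N}" using finite_nat_bounded by blast
      then have "closure (?U c N) \<subseteq> (\<Inter>n\<in>I. closure (?U c n))"
        by (intro INT_greatest dec) auto
      moreover have "closure (?U c N) \<noteq> {}" using ne[rule_format, of "initial_word c N"] by simp
      ultimately show "UNIV \<inter> (\<Inter>n\<in>I. closure (?U c n)) \<noteq> {}"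
        unfolding Int_UNIV_left by (metis subset_empty)
    qed simp
    then obtain x where "\<And>n. x \<in> closure (?U c n)" by auto
    then have "\<forall>n. x \<in> ?U c n" using subsetD[OF step] by metis
    then show ?thesis ..
  qed
  then have "\<forall>c. \<exists>x. \<forall>n. x \<in> ?U c n" ..
  from choice[OF this] obtain \<theta> where \<theta>: "\<And>c n. \<theta> c \<in> ?U c n" by auto
  \<comment> \<open>The coordinates of c from n on are replaced by False. The word of length n is unchanged, so the
    images of c and of its truncation under \<theta> lie in a common set of diameter below 1 / n.\<close>
  define trunc where "trunc n c = (\<lambda>i. i < n \<and> c i)" for n and c :: "nat \<Rightarrow> bool"
  have trunc: "initial_word (trunc n c) n = initial_word c n" for n c
    by (simp add: trunc_def initial_word_def)
  have meas: "(\<lambda>c. u (\<theta> c)) \<in> borel_measurable coin" if u: "continuous_on UNIV u" for u :: "'k \<Rightarrow> real"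
  proof (rule borel_measurable_LIMSEQ_real)
    show "(\<lambda>n. u (\<theta> (trunc n c))) \<longlonglongrightarrow> u (\<theta> c)" for c
    proof (rule LIMSEQ_I)
      fix r :: real assume r: "0 < r"
      have "open {x. \<bar>u x - u (\<theta> c)\<bar> < r}" using u by (intro open_Collect_less continuous_intros)
      then have "openin mtopology {x. \<bar>u x - u (\<theta> c)\<bar> < r}" using d(2) by simp
      then obtain e where e: "0 < e" "mball (\<theta> c) e \<subseteq> {x. \<bar>u x - u (\<theta> c)\<bar> < r}"
        unfolding openin_mtopology using r by (metis (mono_tags, lifting) abs_zero cancel_comm_monoid_add_class.diff_cancel mem_Collect_eq)
      obtain N where N: "1 / real (Suc N) < e" using e(1) nat_approx_posE by blast
      have "norm (u (\<theta> (trunc n c)) - u (\<theta> c)) < r" if n: "n \<ge> Suc N" for n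
      proof -
        obtain k where k: "n = Suc k" "N \<le> k" using n by (cases n) auto
        have "\<theta> (trunc n c) \<in> ?U c n" using \<theta>[of "trunc n c" n] by (simp add: trunc)
        then have "d (\<theta> c) (\<theta> (trunc n c)) < 1 / real (Suc k)"
          using \<theta>[of c n] unfolding k(1) by (intro diam[rule_format, of "initial_word c (Suc k)"]) simp_all
        also have "\<dots> \<le> 1 / real (Suc N)" using k(2) by (simp add: frac_le)
        finally have "\<theta> (trunc n c) \<in> mball (\<theta> c) e" using N by simp
        then show ?thesis using e(2) by auto
      qed
      then show "\<exists>N. \<forall>n\<ge>N. norm (u (\<theta> (trunc n c)) - u (\<theta> c)) < r" by blast
    qed
    fix n
    have "u (\<theta> (trunc n c)) = (\<lambda>\<sigma>. u (\<theta> (\<lambda>i. i < n \<and> \<sigma> ! i))) (initial_word c n)" for c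
      by (auto simp: trunc_def initial_word_def intro!: arg_cong[where f=u] arg_cong[where f=\<theta>])
    then show "(\<lambda>c. u (\<theta> (trunc n c))) \<in> borel_measurable coin"
      using measurable_compose[OF measurable_initial_word, of "\<lambda>\<sigma>. u (\<theta> (\<lambda>i. i < n \<and> \<sigma> ! i))" borel n] by simp
  qed
  show ?thesis
  proof (intro exI[of _ h] exI[of _ \<theta>] conjI allI impI)
    show "b < h n (\<theta> c)" if "c n" for n c
      using hT[rule_format, of "\<theta> c" "initial_word c n"] \<theta>[of c "Suc n"] that by (simp add: initial_word_Suc)
    show "h n (\<theta> c) < a" if "\<not> c n" for n c
      using hF[rule_format, of "\<theta> c" "initial_word c n"] \<theta>[of c "Suc n"] that by (simp add: initial_word_Suc)
  qed (use hB meas in auto)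
qed

text \<open>
  Where c n holds and c m fails, h n \<circ> \<theta> exceeds h m \<circ> \<theta> by more than b - a. This event has
  probability 1 / 4, so the h n \<circ> \<theta> cannot lie in an L1-totally bounded set.
\<close>

theorem hull_not_splitting:
  fixes F :: "'i \<Rightarrow> 'k::t2_space \<Rightarrow> real"
  assumes comp: "compact (UNIV :: 'k set)" and metr: "metrizable_space (euclidean :: 'k topology)"
    and cont: "\<And>s. continuous_on UNIV (F s)" and bound: "\<And>s x. \<bar>F s x\<bar> \<le> C"
    and seq: "seq_compact_family F" and ab: "a < b"
  shows "\<not> splits_open_sets (function_hull F) a b"
proof
  assume split: "splits_open_sets (function_hull F) a b"
  have hcont: "\<forall>h\<in>function_hull F. continuous_on UNIV h"
    using cont unfolding function_hull_def by (auto intro!: continuous_intros)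
  obtain h :: "nat \<Rightarrow> 'k \<Rightarrow> real" and \<theta> :: "(nat \<Rightarrow> bool) \<Rightarrow> 'k"
    where h: "\<forall>n. h n \<in> function_hull F"
      and hi: "\<forall>n c. c n \<longrightarrow> b < h n (\<theta> c)" and lo: "\<forall>n c. \<not> c n \<longrightarrow> h n (\<theta> c) < a"
      and meas: "\<forall>u :: 'k \<Rightarrow> real. continuous_on UNIV u \<longrightarrow> (\<lambda>c. u (\<theta> c)) \<in> borel_measurable coin"
    using independent_sequence[OF comp metr hcont split] by (elim exE conjE) (rule that)
  note measF = meas[rule_format, OF cont]
  interpret prob_space coin by (rule prob_space_coin)
  obtain n m where nm: "n \<noteq> m" and close: "(\<integral>c. \<bar>h n (\<theta> c) - h m (\<theta> c)\<bar> \<partial>coin) < (b - a) / 4"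
    using function_hull_totally_bounded[OF prob_space_coin measF bound seq_compact_family_comp[OF seq],
        where h = "\<lambda>n c. h n (\<theta> c)" and e = "(b - a) / 4"] function_hull_comp[of _ F \<theta>] h ab
    by auto
  have ihn: "integrable coin (\<lambda>c. h k (\<theta> c))" for k
  proof -
    have "integrable coin (\<lambda>c. F s (\<theta> c))" for s
      using bound measF by (intro integrable_const_bound[of _ C]) auto
    then show ?thesis
      using h[rule_format, of k] unfolding function_hull_def
      by (auto intro!: Bochner_Integration.integrable_sum integrable_mult_right)
  qed
  let ?A = "{c::nat \<Rightarrow> bool. c n \<and> \<not> c m}"
  have A: "?A \<in> sets coin"
  proof -
    have "{c\<in>space coin. c n \<and> \<not> c m} \<in> sets coin" by measurable
    then show ?thesis by simp
  qed
  have "(b - a) / 4 = (\<integral>c. (b - a) * indicator ?A c \<partial>coin)"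
    using A measure_coin_distinct_coordinates[OF nm] by simp
  also have "\<dots> \<le> (\<integral>c. \<bar>h n (\<theta> c) - h m (\<theta> c)\<bar> \<partial>coin)"
  proof (rule integral_mono)
    show "integrable coin (\<lambda>c. (b - a) * indicat_real ?A c)"
      using A by (intro integrable_mult_right integrable_real_indicator) (simp_all add: less_top[symmetric])
    show "integrable coin (\<lambda>c. \<bar>h n (\<theta> c) - h m (\<theta> c)\<bar>)"
      by (intro integrable_abs Bochner_Integration.integrable_diff ihn)
    show "(b - a) * indicator ?A c \<le> \<bar>h n (\<theta> c) - h m (\<theta> c)\<bar>" for c
      using hi[rule_format, of c n] lo[rule_format, of c m] by (auto simp: indicator_def)
  qed
  finally show False using close by simp
qed

section \<open>Real invariant means\<close>

lemma bcontfunI_real: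
  fixes f :: "'a::topological_space \<Rightarrow> real"
  assumes "continuous_on UNIV f" "\<And>t. \<bar>f t\<bar> \<le> B"
  shows "f \<in> bcontfun"
  using assms by (auto simp: bcontfun_def bounded_iff)

lemma bcontfun_bound:
  fixes f :: "'a::topological_space \<Rightarrow> real"
  assumes "f \<in> bcontfun"
  obtains B where "\<And>t. \<bar>f t\<bar> \<le> B"
  using assms by (auto simp: bcontfun_def bounded_iff)

lemma bcontfun_add:
  fixes f g :: "'a::topological_space \<Rightarrow> real"
  assumes "f \<in> bcontfun" "g \<in> bcontfun"
  shows "(\<lambda>t. f t + g t) \<in> bcontfun"
  using assms by (auto simp: bcontfun_def intro!: continuous_intros bounded_plus_comp)

lemma bcontfun_cmult:
  fixes f :: "'a::topological_space \<Rightarrow> real"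
  assumes "f \<in> bcontfun"
  shows "(\<lambda>t. c * f t) \<in> bcontfun"
proof -
  obtain B where B: "\<And>t. \<bar>f t\<bar> \<le> B" using bcontfun_bound[OF assms] by blast
  show ?thesis
    using assms B
    by (intro bcontfunI_real[of _ "\<bar>c\<bar> * B"]) (auto simp: bcontfun_def abs_mult intro!: continuous_intros mult_left_mono)
qed

lemma bcontfun_sum:
  fixes f :: "'i \<Rightarrow> 'a::topological_space \<Rightarrow> real"
  assumes "\<And>i. i \<in> I \<Longrightarrow> f i \<in> bcontfun"
  shows "(\<lambda>t. \<Sum>i\<in>I. f i t) \<in> bcontfun"
  using assms
proof (induction I rule: infinite_finite_induct)
  case (insert i I)
  then show ?case using bcontfun_add[of "f i" "\<lambda>t. \<Sum>i\<in>I. f i t"] by simp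
qed (simp_all add: const_bcontfun)

lemma continuous_left_translation: "continuous_on UNIV (\<lambda>t. s * t :: 's::semitopological_semigroup)"
  and continuous_right_translation: "continuous_on UNIV (\<lambda>t. t * s :: 's::semitopological_semigroup)"
  by (simp_all add: continuous_on_open_vimage continuous_mult_left continuous_mult_right)

lemma bcontfun_translate:
  fixes f :: "'s::semitopological_semigroup \<Rightarrow> real"
  assumes "f \<in> bcontfun"
  shows "(\<lambda>t. f (s * t)) \<in> bcontfun" "(\<lambda>t. f (t * s)) \<in> bcontfun"
  using assms
  by (auto simp: bcontfun_def intro: continuous_on_compose2[OF _ continuous_left_translation]
      continuous_on_compose2[OF _ continuous_right_translation] bounded_subset)

text \<open>
  An invariant mean restricted to real functions; as for the complex one, only the values at
  bounded continuous functions are constrained.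
\<close>

locale real_invariant_mean =
  fixes M :: "('s::semitopological_semigroup \<Rightarrow> real) \<Rightarrow> real"
  assumes add: "f \<in> bcontfun \<Longrightarrow> g \<in> bcontfun \<Longrightarrow> M (\<lambda>t. f t + g t) = M f + M g"
    and scale: "f \<in> bcontfun \<Longrightarrow> M (\<lambda>t. c * f t) = c * M f"
    and nonneg: "f \<in> bcontfun \<Longrightarrow> (\<And>t. 0 \<le> f t) \<Longrightarrow> 0 \<le> M f"
    and one: "M (\<lambda>_. 1) = 1"
    and left: "f \<in> bcontfun \<Longrightarrow> M (\<lambda>t. f (s * t)) = M f"
    and right: "f \<in> bcontfun \<Longrightarrow> M (\<lambda>t. f (t * s)) = M f"
begin

lemma const: "M (\<lambda>_. c) = c"
  using scale[of "\<lambda>_. 1" c] one by (simp add: const_bcontfun)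

lemma diff:
  assumes "f \<in> bcontfun" "g \<in> bcontfun"
  shows "M (\<lambda>t. f t - g t) = M f - M g"
  using add[of f "\<lambda>t. (- 1) * g t"] scale[of g "- 1"] bcontfun_cmult[of g "- 1"] assms by simp

lemma sum_finite:
  assumes "\<And>i. i \<in> I \<Longrightarrow> f i \<in> bcontfun"
  shows "M (\<lambda>t. \<Sum>i\<in>I. f i t) = (\<Sum>i\<in>I. M (f i))"
  using assms
proof (induction I rule: infinite_finite_induct)
  case (insert i I)
  then show ?case using add[of "f i" "\<lambda>t. \<Sum>i\<in>I. f i t"] bcontfun_sum[of I f] by simp
qed (simp_all add: const)

lemma abs_le:
  assumes f: "f \<in> bcontfun" and e: "\<And>t. \<bar>f t\<bar> \<le> e"
  shows "\<bar>M f\<bar> \<le> e"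
proof -
  have c: "(\<lambda>_. e) \<in> bcontfun" by (rule const_bcontfun)
  have "0 \<le> M (\<lambda>t. e - f t)" "0 \<le> M (\<lambda>t. e + f t)"
    using e bcontfun_add[OF c bcontfun_cmult[OF f, of "- 1"]] bcontfun_add[OF c f]
    by (intro nonneg; simp add: abs_le_iff; smt (verit))+
  then show ?thesis using diff[OF c f] add[OF c f] const[of e] by linarith
qed

text \<open>
  A mean acts only on continuous functions, so the indicator functions of the cells of a finite net
  S0 are not available. Instead a continuous partition of unity \<phi> subordinate to the balls of radius
  e around the points of S0 is used, with weights w a = M (\<phi> a). Each v that varies no faster than
  p has \<Sum>a. \<phi> a s * v a within e of v s for every s, and applying M gives the claim. The weights
  do not depend on v.
\<close>

lemma averaging_weights:
  fixes p :: "'s \<Rightarrow> 's \<Rightarrow> real"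
  assumes S0: "finite S0" "\<And>s. \<exists>a\<in>S0. p s a < e" and cont: "\<And>a. continuous_on UNIV (\<lambda>s. p s a)"
  shows "\<exists>w. (\<forall>a\<in>S0. 0 \<le> w a) \<and> (\<Sum>a\<in>S0. w a) = 1 \<and>
    (\<forall>v\<in>bcontfun. (\<forall>s a. \<bar>v s - v a\<bar> \<le> p s a) \<longrightarrow> \<bar>(\<Sum>a\<in>S0. w a * v a) - M v\<bar> \<le> e)"
proof -
  define D where "D s = (\<Sum>a\<in>S0. max 0 (e - p s a))" for s
  define \<phi> where "\<phi> a s = max 0 (e - p s a) / D s" for a s
  have D: "0 < D s" for s
  proof -
    obtain a where "a \<in> S0" "p s a < e" using S0(2) by blast
    then show ?thesis unfolding D_def using S0(1) by (intro sum_pos2[of _ a]) auto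
  qed
  have \<phi>0: "0 \<le> \<phi> a s" for a s using D[of s] by (simp add: \<phi>_def)
  have \<phi>sum: "(\<Sum>a\<in>S0. \<phi> a s) = 1" for s
    using D[of s] by (simp add: \<phi>_def sum_divide_distrib[symmetric] D_def[symmetric])
  have \<phi>b: "\<phi> a \<in> bcontfun" if "a \<in> S0" for a
  proof (rule bcontfunI_real)
    show "continuous_on UNIV (\<phi> a)"
      unfolding \<phi>_def D_def using D unfolding D_def
      by (intro continuous_intros cont) (metis less_irrefl)
    show "\<bar>\<phi> a s\<bar> \<le> 1" for s
      using member_le_sum[of a S0 "\<lambda>a. \<phi> a s"] \<phi>0 \<phi>sum that S0(1) by simp
  qed
  show ?thesis
  proof (intro exI[of _ "\<lambda>a. M (\<phi> a)"] conjI ballI impI)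
    show "0 \<le> M (\<phi> a)" if "a \<in> S0" for a by (rule nonneg[OF \<phi>b[OF that] \<phi>0])
    show "(\<Sum>a\<in>S0. M (\<phi> a)) = 1" using sum_finite[of S0 \<phi>] \<phi>b by (simp add: \<phi>sum one)
    fix v :: "'s \<Rightarrow> real" assume v: "v \<in> bcontfun" and vp: "\<forall>s a. \<bar>v s - v a\<bar> \<le> p s a"
    let ?g = "\<lambda>s. \<Sum>a\<in>S0. v a * \<phi> a s"
    have g: "?g \<in> bcontfun" by (intro bcontfun_sum bcontfun_cmult \<phi>b)
    have "(\<Sum>a\<in>S0. M (\<phi> a) * v a) = M ?g"
      using sum_finite[of S0 "\<lambda>a s. v a * \<phi> a s"] by (simp add: bcontfun_cmult \<phi>b scale mult.commute)
    then have "(\<Sum>a\<in>S0. M (\<phi> a) * v a) - M v = M (\<lambda>s. ?g s - v s)"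
      using diff[OF g v] by simp
    also have "\<bar>\<dots>\<bar> \<le> e"
    proof (rule abs_le)
      show "(\<lambda>s. ?g s - v s) \<in> bcontfun" using bcontfun_add[OF g bcontfun_cmult[OF v, of "- 1"]] by simp
      fix s
      have "?g s - v s = (\<Sum>a\<in>S0. \<phi> a s * (v a - v s))"
        using \<phi>sum[of s] by (simp add: right_diff_distrib sum_subtractf sum_distrib_left[symmetric] mult.commute)
      also have "\<bar>\<dots>\<bar> \<le> (\<Sum>a\<in>S0. \<bar>\<phi> a s * (v a - v s)\<bar>)" by (rule sum_abs)
      also have "\<dots> \<le> (\<Sum>a\<in>S0. \<phi> a s * e)"
      proof (rule sum_mono)
        fix a
        have "\<phi> a s * \<bar>v a - v s\<bar> \<le> \<phi> a s * e"
        proof (cases "p s a < e")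
          case True
          then show ?thesis using vp[rule_format, of s a] \<phi>0 by (intro mult_left_mono) auto
        qed (simp add: \<phi>_def)
        then show "\<bar>\<phi> a s * (v a - v s)\<bar> \<le> \<phi> a s * e" using \<phi>0 by (simp add: abs_mult)
      qed
      also have "\<dots> = e" using \<phi>sum[of s] by (simp add: sum_distrib_right[symmetric])
      finally show "\<bar>?g s - v s\<bar> \<le> e" .
    qed
    finally show "\<bar>(\<Sum>a\<in>S0. M (\<phi> a) * v a) - M v\<bar> \<le> e" .
  qed
qed

end

lemma amenable_imp_real_invariant_mean:
  assumes "amenable TYPE('s::semitopological_semigroup)"
  shows "\<exists>M :: ('s \<Rightarrow> real) \<Rightarrow> real. real_invariant_mean M"
proof -
  obtain m :: "('s \<Rightarrow> complex) \<Rightarrow> complex" where m: "invariant_mean m"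
    using assms by (auto simp: amenable_def)
  have b: "(\<lambda>t. complex_of_real (f t)) \<in> bcontfun" if "f \<in> bcontfun" for f :: "'s \<Rightarrow> real"
    using that by (auto simp: bcontfun_def bounded_iff intro!: continuous_intros)
  have m_add: "\<forall>f\<in>bcontfun. \<forall>g\<in>bcontfun. m (\<lambda>t. f t + g t) = m f + m g"
    and m_scale: "\<forall>c. \<forall>f\<in>bcontfun. m (\<lambda>t. c * f t) = c * m f"
    using m unfolding invariant_mean_def Cb_dual_def by blast+
  have "real_invariant_mean (\<lambda>f. Re (m (\<lambda>t. complex_of_real (f t))))"
  proof
    fix f g :: "'s \<Rightarrow> real" and c and s
    assume f: "f \<in> bcontfun"
    have "m (\<lambda>t. complex_of_real c * complex_of_real (f t)) = complex_of_real c * m (\<lambda>t. complex_of_real (f t))"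
      by (rule m_scale[rule_format, OF b[OF f]])
    then show "Re (m (\<lambda>t. complex_of_real (c * f t))) = c * Re (m (\<lambda>t. complex_of_real (f t)))" by simp
    show "Re (m (\<lambda>t. complex_of_real (f (s * t)))) = Re (m (\<lambda>t. complex_of_real (f t)))"
      "Re (m (\<lambda>t. complex_of_real (f (t * s)))) = Re (m (\<lambda>t. complex_of_real (f t)))"
      using m b[OF f] by (auto simp: invariant_mean_def left_translate_def right_translate_def)
    show "0 \<le> Re (m (\<lambda>t. complex_of_real (f t)))" if "\<And>t. 0 \<le> f t"
    proof -
      have "m (\<lambda>t. complex_of_real (f t)) \<in> \<real>\<^sub>\<ge>\<^sub>0"
        using m b[OF f] that unfolding invariant_mean_def by (simp add: nonneg_Reals_def)
      then show ?thesis by (simp add: complex_nonneg_Reals_iff)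
    qed
    assume g: "g \<in> bcontfun"
    have "m (\<lambda>t. complex_of_real (f t) + complex_of_real (g t)) =
        m (\<lambda>t. complex_of_real (f t)) + m (\<lambda>t. complex_of_real (g t))"
      by (rule m_add[rule_format, OF b[OF f] b[OF g]])
    then show "Re (m (\<lambda>t. complex_of_real (f t + g t))) =
        Re (m (\<lambda>t. complex_of_real (f t))) + Re (m (\<lambda>t. complex_of_real (g t)))" by simp
  next
    show "Re (m (\<lambda>t. complex_of_real 1)) = 1" using m by (simp add: invariant_mean_def)
  qed
  then show ?thesis by blast
qed

section \<open>Almost invariant averages\<close>

text \<open>
  Invariance tested on real functions only, and without regularity.
\<close>

definition invariant_probability :: "('s \<Rightarrow> 'k::topological_space \<Rightarrow> 'k) \<Rightarrow> 'k measure \<Rightarrow> bool" where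
  "invariant_probability act \<mu> \<longleftrightarrow> sets \<mu> = sets borel \<and> prob_space \<mu> \<and>
     (\<forall>s. \<forall>f :: 'k \<Rightarrow> real. continuous_on UNIV f \<longrightarrow> (\<integral>x. f (act s x) \<partial>\<mu>) = (\<integral>x. f x \<partial>\<mu>))"

context topological_dynamical_system
begin

lemma continuous_act_point: "continuous_on UNIV (act s)"
proof -
  have "continuous_on UNIV (\<lambda>x. (\<lambda>(s, x). act s x) (s, x))"
    by (rule continuous_on_compose2[OF continuous_act]) (auto intro!: continuous_intros)
  then show ?thesis by simp
qed

lemma continuous_orbit:
  "continuous_on UNIV f \<Longrightarrow> continuous_on UNIV (\<lambda>x. f (act s x))"
  by (rule continuous_on_compose2[OF _ continuous_act_point]) auto

text \<open>
  Compactness of the space makes s \<mapsto> f (s _) continuous for the uniform norm, so every v that is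
  Lipschitz for this norm is continuous. Dominated convergence would give this only along
  sequences, and the topology of the semigroup need not be determined by sequences.
\<close>

lemma continuous_in_semigroup:
  fixes f :: "'k \<Rightarrow> real" and v :: "'s \<Rightarrow> real"
  assumes f: "continuous_on UNIV f"
    and v: "\<And>s s' e. (\<And>x. \<bar>f (act s x) - f (act s' x)\<bar> \<le> e) \<Longrightarrow> \<bar>v s - v s'\<bar> \<le> e"
  shows "continuous_on UNIV v"
  unfolding continuous_on_def
proof (intro ballI tendstoI)
  fix s :: 's and e :: real assume e: "0 < e"
  have "continuous_on (UNIV \<times> UNIV) (\<lambda>p. f ((\<lambda>(s, x). act s x) p))"
    using continuous_act f by (intro continuous_on_compose2[OF f]) auto
  then obtain X where X: "s \<in> X" "open X"
    "\<forall>t\<in>X \<inter> UNIV. \<forall>x\<in>UNIV. dist (f ((\<lambda>(s, x). act s x) (t, x))) (f ((\<lambda>(s, x). act s x) (s, x))) \<le> e / 2"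
    using e by (elim continuous_on_prod_compactE[OF _ compact_UNIV, of UNIV _ s "e / 2"]) auto
  have "dist (v t) (v s) < e" if "t \<in> X" for t
    using v[of t s "e / 2"] X(3) that e by (force simp: dist_real_def)
  then show "\<forall>\<^sub>F t in at s within UNIV. dist (v t) (v s) < e"
    using X(1,2) by (auto simp: eventually_at_topological)
qed

lemma integrable_continuous:
  fixes f :: "'k \<Rightarrow> real"
  assumes \<mu>: "sets \<mu> = sets borel" "prob_space \<mu>" and f: "continuous_on UNIV f"
  shows "integrable \<mu> f"
proof -
  interpret prob_space \<mu> by (rule \<mu>)
  obtain B where "\<And>x. \<bar>f x\<bar> \<le> B" using continuous_bounded[OF compact_UNIV f] by blast
  moreover have "f \<in> borel_measurable \<mu>"
    using borel_measurable_continuous_onI[OF f] by (simp add: measurable_cong_sets[OF \<mu>(1) refl])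
  ultimately show ?thesis by (intro integrable_const_bound[of _ B]) auto
qed

lemma function_hull_orbit_integral:
  assumes \<mu>: "invariant_probability act \<mu>" and f: "continuous_on UNIV f"
    and h: "h \<in> function_hull (\<lambda>s x. f (act s x))"
  shows "integral\<^sup>L \<mu> h = integral\<^sup>L \<mu> f"
proof -
  obtain S w where S: "finite S" "(\<Sum>s\<in>S. w s) = 1" and h_eq: "h = (\<lambda>x. \<Sum>s\<in>S. w s * f (act s x))"
    using h unfolding function_hull_def by auto
  have i: "integrable \<mu> (\<lambda>x. f (act s x))" for s
    using \<mu> continuous_orbit[OF f] by (intro integrable_continuous) (auto simp: invariant_probability_def)
  have "integral\<^sup>L \<mu> h = (\<Sum>s\<in>S. w s * (\<integral>x. f (act s x) \<partial>\<mu>))"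
    unfolding h_eq using i by (subst Bochner_Integration.integral_sum) auto
  also have "\<dots> = (\<Sum>s\<in>S. w s * integral\<^sup>L \<mu> f)"
    using \<mu> f unfolding invariant_probability_def by simp
  finally show ?thesis using S(2) by (simp add: sum_distrib_right[symmetric])
qed

end

locale amenable_system = topological_dynamical_system act + real_invariant_mean M
  for act :: "'s::semitopological_semigroup \<Rightarrow> 'k::t2_space \<Rightarrow> 'k" and M :: "('s \<Rightarrow> real) \<Rightarrow> real"
begin

lemma L1_distance_continuous:
  fixes f :: "'k \<Rightarrow> real"
  assumes \<mu>: "invariant_probability act \<mu>" and f: "continuous_on UNIV f"
  shows "continuous_on UNIV (\<lambda>s. \<integral>x. \<bar>f (act s x) - f (act a x)\<bar> \<partial>\<mu>)"
proof (rule continuous_in_semigroup[OF f])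
  interpret prob_space \<mu> using \<mu> by (simp add: invariant_probability_def)
  have sets: "sets \<mu> = sets borel" using \<mu> by (simp add: invariant_probability_def)
  have i: "integrable \<mu> (\<lambda>x. \<bar>f (act s x) - f (act a x)\<bar>)" for s
    by (intro integrable_continuous sets prob_space_axioms continuous_intros continuous_orbit f)
  fix s s' e assume le: "\<And>x. \<bar>f (act s x) - f (act s' x)\<bar> \<le> e"
  have "\<bar>(\<integral>x. \<bar>f (act s x) - f (act a x)\<bar> \<partial>\<mu>) - (\<integral>x. \<bar>f (act s' x) - f (act a x)\<bar> \<partial>\<mu>)\<bar> =
      \<bar>\<integral>x. \<bar>f (act s x) - f (act a x)\<bar> - \<bar>f (act s' x) - f (act a x)\<bar> \<partial>\<mu>\<bar>"
    using i by simp
  also have "\<dots> \<le> (\<integral>x. \<bar>\<bar>f (act s x) - f (act a x)\<bar> - \<bar>f (act s' x) - f (act a x)\<bar>\<bar> \<partial>\<mu>)"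
    by (rule integral_abs_bound)
  also have "\<dots> \<le> (\<integral>x. e \<partial>\<mu>)"
  proof (rule integral_mono)
    show "\<bar>\<bar>f (act s x) - f (act a x)\<bar> - \<bar>f (act s' x) - f (act a x)\<bar>\<bar> \<le> e" for x
      using le[of x] by linarith
  qed (use i in \<open>auto intro!: integrable_abs Bochner_Integration.integrable_diff simp del: integrable_abs_iff\<close>)
  also have "\<dots> = e" by (simp add: prob_space)
  finally show "\<bar>(\<integral>x. \<bar>f (act s x) - f (act a x)\<bar> \<partial>\<mu>) - (\<integral>x. \<bar>f (act s' x) - f (act a x)\<bar> \<partial>\<mu>)\<bar> \<le> e" .
qed

text \<open>
  Duality: the L1-norm of h (t _) - h is its integral against its own sign \<sigma>. For fixed \<sigma> the
  function v s = \<integral>\<sigma> (x) f (s x) d\<mu> is bounded, continuous and Lipschitz for the L1-distance of the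
  orbit, and so is its right translate by t, because \<mu> is invariant. The weighted averages of both
  are within e of their means, and these means agree by right invariance.
\<close>

lemma average_almost_invariant:
  fixes f :: "'k \<Rightarrow> real"
  assumes \<mu>: "invariant_probability act \<mu>" and f: "continuous_on UNIV f"
    and w: "\<And>v. v \<in> bcontfun \<Longrightarrow> (\<And>s a. \<bar>v s - v a\<bar> \<le> (\<integral>x. \<bar>f (act s x) - f (act a x)\<bar> \<partial>\<mu>)) \<Longrightarrow>
        \<bar>(\<Sum>a\<in>S0. w a * v a) - M v\<bar> \<le> e"
    and h: "h = (\<lambda>x. \<Sum>a\<in>S0. w a * f (act a x))"
  shows "(\<integral>x. \<bar>h (act t x) - h x\<bar> \<partial>\<mu>) \<le> 2 * e"
proof -
  interpret prob_space \<mu> using \<mu> by (simp add: invariant_probability_def)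
  have sets [measurable_cong]: "sets \<mu> = sets borel" using \<mu> by (simp add: invariant_probability_def)
  obtain B where B: "\<And>x. \<bar>f x\<bar> \<le> B" using continuous_bounded[OF compact_UNIV f] by blast
  define \<sigma> where "\<sigma> x = sgn (h (act t x) - h x)" for x
  have hc: "continuous_on UNIV h" unfolding h by (intro continuous_intros continuous_orbit f)
  have cd: "continuous_on UNIV (\<lambda>x. h (act t x) - h x)"
    by (intro continuous_intros continuous_orbit hc)
  have \<sigma>m [measurable]: "\<sigma> \<in> borel_measurable \<mu>"
  proof -
    have [measurable]: "(\<lambda>x. h (act t x) - h x) \<in> borel_measurable \<mu>"
      by (intro borel_measurable_integrable integrable_continuous sets prob_space_axioms cd)
    show ?thesis unfolding \<sigma>_def sgn_real_def by measurable
  qed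
  have \<sigma>1: "\<bar>\<sigma> x\<bar> \<le> 1" for x by (simp add: \<sigma>_def abs_sgn_eq)
  have fi: "integrable \<mu> (\<lambda>x. f (act s x))" for s
    by (intro integrable_continuous sets prob_space_axioms continuous_orbit f)
  have \<sigma>i: "integrable \<mu> (\<lambda>x. \<sigma> x * g x)" if "integrable \<mu> g" for g
  proof (rule Bochner_Integration.integrable_bound[OF that])
    show "AE x in \<mu>. norm (\<sigma> x * g x) \<le> norm (g x)"
      using \<sigma>1 by (simp add: abs_mult mult_left_le_one_le)
  qed (use that in measurable)
  define v where "v s = (\<integral>x. \<sigma> x * f (act s x) \<partial>\<mu>)" for s
  have v_diff: "\<bar>v s - v a\<bar> \<le> (\<integral>x. \<bar>f (act s x) - f (act a x)\<bar> \<partial>\<mu>)" for s a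
  proof -
    have "v s - v a = (\<integral>x. \<sigma> x * f (act s x) - \<sigma> x * f (act a x) \<partial>\<mu>)"
      unfolding v_def by (rule Bochner_Integration.integral_diff[symmetric]) (intro \<sigma>i fi)+
    also have "\<dots> = (\<integral>x. \<sigma> x * (f (act s x) - f (act a x)) \<partial>\<mu>)" by (simp add: right_diff_distrib)
    also have "\<bar>\<dots>\<bar> \<le> (\<integral>x. \<bar>\<sigma> x * (f (act s x) - f (act a x))\<bar> \<partial>\<mu>)" by (rule integral_abs_bound)
    also have "\<dots> \<le> (\<integral>x. \<bar>f (act s x) - f (act a x)\<bar> \<partial>\<mu>)"
    proof (rule integral_mono)
      show "\<bar>\<sigma> x * (f (act s x) - f (act a x))\<bar> \<le> \<bar>f (act s x) - f (act a x)\<bar>" for x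
        using \<sigma>1 by (simp add: abs_mult mult_left_le_one_le)
    qed (intro integrable_abs \<sigma>i Bochner_Integration.integrable_diff fi)+
    finally show ?thesis .
  qed
  have v_cont: "continuous_on UNIV v"
  proof (rule continuous_in_semigroup[OF f])
    fix s s' d assume le: "\<And>x. \<bar>f (act s x) - f (act s' x)\<bar> \<le> d"
    have "(\<integral>x. \<bar>f (act s x) - f (act s' x)\<bar> \<partial>\<mu>) \<le> (\<integral>x. d \<partial>\<mu>)"
      using le by (intro integral_mono integrable_abs Bochner_Integration.integrable_diff fi) auto
    then show "\<bar>v s - v s'\<bar> \<le> d" using v_diff[of s s'] by (simp add: prob_space)
  qed
  have v_bound: "\<bar>v s\<bar> \<le> B" for s
  proof -
    have "\<bar>v s\<bar> \<le> (\<integral>x. \<bar>\<sigma> x * f (act s x)\<bar> \<partial>\<mu>)" unfolding v_def by (rule integral_abs_bound)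
    also have "\<dots> \<le> (\<integral>x. B \<partial>\<mu>)"
    proof (rule integral_mono)
      show "\<bar>\<sigma> x * f (act s x)\<bar> \<le> B" for x
        using mult_mono[OF \<sigma>1[of x] B[of "act s x"]] by (simp add: abs_mult)
    qed (intro integrable_abs \<sigma>i fi, simp)
    finally show ?thesis by (simp add: prob_space)
  qed
  have v: "v \<in> bcontfun" by (rule bcontfunI_real[OF v_cont v_bound])
  have vt_diff: "\<bar>v (s * t) - v (a * t)\<bar> \<le> (\<integral>x. \<bar>f (act s x) - f (act a x)\<bar> \<partial>\<mu>)" for s a
  proof -
    have "(\<integral>x. \<bar>f (act (s * t) x) - f (act (a * t) x)\<bar> \<partial>\<mu>) = (\<integral>x. (\<lambda>y. \<bar>f (act s y) - f (act a y)\<bar>) (act t x) \<partial>\<mu>)"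
      by (simp add: act_mult)
    also have "\<dots> = (\<integral>x. \<bar>f (act s x) - f (act a x)\<bar> \<partial>\<mu>)"
    proof -
      have "continuous_on UNIV (\<lambda>y. \<bar>f (act s y) - f (act a y)\<bar>)"
        by (intro continuous_intros continuous_orbit f)
      then show ?thesis using \<mu> unfolding invariant_probability_def by blast
    qed
    finally show ?thesis using v_diff[of "s * t" "a * t"] by simp
  qed
  have "\<bar>(\<Sum>a\<in>S0. w a * v a) - M v\<bar> \<le> e" by (rule w[OF v v_diff])
  moreover have "\<bar>(\<Sum>a\<in>S0. w a * v (a * t)) - M v\<bar> \<le> e"
    using w[OF bcontfun_translate(2)[OF v] vt_diff] right[OF v, of t] by simp
  moreover have "(\<integral>x. \<bar>h (act t x) - h x\<bar> \<partial>\<mu>) = (\<Sum>a\<in>S0. w a * v (a * t)) - (\<Sum>a\<in>S0. w a * v a)"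
  proof -
    have "(\<integral>x. \<bar>h (act t x) - h x\<bar> \<partial>\<mu>) =
        (\<integral>x. (\<Sum>a\<in>S0. w a * (\<sigma> x * f (act (a * t) x))) - (\<Sum>a\<in>S0. w a * (\<sigma> x * f (act a x))) \<partial>\<mu>)"
    proof (rule Bochner_Integration.integral_cong[OF refl])
      fix x
      have "\<bar>h (act t x) - h x\<bar> = \<sigma> x * (h (act t x) - h x)"
        unfolding \<sigma>_def by (metis abs_sgn mult.commute)
      then show "\<bar>h (act t x) - h x\<bar> = (\<Sum>a\<in>S0. w a * (\<sigma> x * f (act (a * t) x))) - (\<Sum>a\<in>S0. w a * (\<sigma> x * f (act a x)))"
        unfolding h by (simp add: act_mult right_diff_distrib sum_distrib_left mult.left_commute)
    qed
    also have "\<dots> = (\<Sum>a\<in>S0. w a * v (a * t)) - (\<Sum>a\<in>S0. w a * v a)"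
      unfolding v_def using \<sigma>i[OF fi]
      by (subst Bochner_Integration.integral_diff) (auto simp: Bochner_Integration.integral_sum)
    finally show ?thesis .
  qed
  ultimately show ?thesis by linarith
qed

text \<open>
  The weights are chosen for the maximum of the two L1-distances, so that the same combination is
  almost invariant for both measures.
\<close>

lemma almost_invariant_average:
  fixes f :: "'k \<Rightarrow> real"
  assumes \<mu>: "invariant_probability act \<mu>" and \<nu>: "invariant_probability act \<nu>"
    and f: "continuous_on UNIV f" and seq: "seq_compact_family (\<lambda>s x. f (act s x))" and e: "0 < e"
  obtains h where "h \<in> function_hull (\<lambda>s x. f (act s x))"
    "\<And>t. (\<integral>x. \<bar>h (act t x) - h x\<bar> \<partial>\<mu>) \<le> e" "\<And>t. (\<integral>x. \<bar>h (act t x) - h x\<bar> \<partial>\<nu>) \<le> e"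
proof -
  let ?p = "\<lambda>\<mu> s a. \<integral>x. \<bar>f (act s x) - f (act a x)\<bar> \<partial>\<mu>"
  have sets: "sets \<mu> = sets borel" "sets \<nu> = sets borel" and prob: "prob_space \<mu>" "prob_space \<nu>"
    using \<mu> \<nu> by (auto simp: invariant_probability_def)
  obtain B where B: "\<And>x. \<bar>f x\<bar> \<le> B" using continuous_bounded[OF compact_UNIV f] by blast
  have meas: "(\<lambda>x. f (act s x)) \<in> borel_measurable \<mu>" "(\<lambda>x. f (act s x)) \<in> borel_measurable \<nu>" for s
    by (intro borel_measurable_integrable integrable_continuous sets prob continuous_orbit f)+
  obtain S0 where S0: "finite S0" "\<And>s. \<exists>a\<in>S0. ?p \<mu> s a < e / 2 \<and> ?p \<nu> s a < e / 2"
    using L1_finite_net2[OF prob meas B seq, of "e / 2"] e by auto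
  have "continuous_on UNIV (\<lambda>s. max (?p \<mu> s a) (?p \<nu> s a))" for a
    by (intro continuous_on_max L1_distance_continuous \<mu> \<nu> f)
  moreover have "\<exists>a\<in>S0. max (?p \<mu> s a) (?p \<nu> s a) < e / 2" for s using S0(2)[of s] by (metis max_less_iff_conj)
  ultimately have "\<exists>w. (\<forall>a\<in>S0. 0 \<le> w a) \<and> (\<Sum>a\<in>S0. w a) = 1 \<and>
      (\<forall>v\<in>bcontfun. (\<forall>s a. \<bar>v s - v a\<bar> \<le> max (?p \<mu> s a) (?p \<nu> s a)) \<longrightarrow>
        \<bar>(\<Sum>a\<in>S0. w a * v a) - M v\<bar> \<le> e / 2)"
    by (intro averaging_weights[OF S0(1)])
  then obtain w where w: "\<And>a. a \<in> S0 \<Longrightarrow> 0 \<le> w a" "(\<Sum>a\<in>S0. w a) = 1"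
    and w': "\<And>v. v \<in> bcontfun \<Longrightarrow> \<forall>s a. \<bar>v s - v a\<bar> \<le> max (?p \<mu> s a) (?p \<nu> s a) \<Longrightarrow>
       \<bar>(\<Sum>a\<in>S0. w a * v a) - M v\<bar> \<le> e / 2"
    by blast
  let ?h = "\<lambda>x. \<Sum>a\<in>S0. w a * f (act a x)"
  have "(\<integral>x. \<bar>?h (act t x) - ?h x\<bar> \<partial>\<mu>) \<le> 2 * (e / 2)" for t
    by (rule average_almost_invariant[OF \<mu> f _ refl], rule w') (auto intro: max.coboundedI1)
  moreover have "(\<integral>x. \<bar>?h (act t x) - ?h x\<bar> \<partial>\<nu>) \<le> 2 * (e / 2)" for t
    by (rule average_almost_invariant[OF \<nu> f _ refl], rule w') (auto intro: max.coboundedI2)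
  moreover have "?h \<in> function_hull (\<lambda>s x. f (act s x))"
    unfolding function_hull_def using S0(1) w(1,2) by blast
  ultimately show ?thesis using that[of ?h] by simp
qed

end

section \<open>Minimality and the comparison of invariant measures\<close>

text \<open>
  The points whose orbits avoid U form a closed invariant set. It is not the whole space, since
  otherwise the complement of U would be a closed invariant set, which minimality excludes. This
  second step stands in for the action of a unit, which the semigroup may lack.
\<close>

lemma (in topological_dynamical_system) minimal_finitely_many_visits:
  assumes min: "minimal_system act" and U: "open U" "U \<noteq> {}"
  obtains T where "finite T" "\<And>x. \<exists>s\<in>T. act s x \<in> U"
proof -
  have op: "open (act s -` U)" for s
    using continuous_on_open_vimage[of UNIV "act s"] continuous_act_point U by auto
  let ?C = "{x. \<forall>s. act s x \<notin> U}"
  have "?C = - (\<Union>s. act s -` U)" by auto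
  moreover have "open (\<Union>s. act s -` U)" using op by blast
  ultimately have "closed ?C" by (simp add: closed_def)
  moreover have "act s ` ?C \<subseteq> ?C" for s by (auto simp: act_mult[symmetric])
  ultimately have C: "?C = {} \<or> ?C = UNIV" using min unfolding minimal_system_def by blast
  have "?C \<noteq> UNIV"
  proof
    assume all: "?C = UNIV"
    then have "act s ` (- U) \<subseteq> - U" for s by blast
    then have "- U = {} \<or> - U = UNIV" using min U(1) unfolding minimal_system_def by (metis closed_Compl)
    then have "U = UNIV" using U(2) by auto
    then show False using all by auto
  qed
  then have "UNIV \<subseteq> (\<Union>s\<in>UNIV. act s -` U)" using C by blast
  then obtain T where "finite T" "UNIV \<subseteq> (\<Union>s\<in>T. act s -` U)"
    using compactE_image[OF compact_UNIV, of UNIV "\<lambda>s. act s -` U"] op by metis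
  then show ?thesis by (intro that[of T]) auto
qed

context amenable_system
begin

text \<open>
  If h were at least a on U, then h x \<ge> a - (\<Sum>s\<in>T. \<bar>h (s x) - h x\<bar>) for every x, because some s \<in> T
  moves x into U; integrating this contradicts the bound on the integral of h.
\<close>

lemma almost_invariant_dips:
  fixes h :: "'k \<Rightarrow> real"
  assumes \<mu>: "invariant_probability act \<mu>" and h: "continuous_on UNIV h"
    and T: "finite T" "\<And>x. \<exists>s\<in>T. act s x \<in> U"
    and inv: "\<And>t. (\<integral>x. \<bar>h (act t x) - h x\<bar> \<partial>\<mu>) \<le> e"
    and less: "integral\<^sup>L \<mu> h + real (card T) * e < a"
  shows "\<exists>x\<in>U. h x < a"
proof (rule ccontr)
  assume "\<not> ?thesis"
  then have ge: "\<And>x. x \<in> U \<Longrightarrow> a \<le> h x" by force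
  interpret prob_space \<mu> using \<mu> by (simp add: invariant_probability_def)
  have sets: "sets \<mu> = sets borel" using \<mu> by (simp add: invariant_probability_def)
  have hi: "integrable \<mu> h" by (intro integrable_continuous sets prob_space_axioms h)
  have di: "integrable \<mu> (\<lambda>x. \<bar>h (act s x) - h x\<bar>)" for s
    by (intro integrable_continuous sets prob_space_axioms continuous_intros continuous_orbit h)
  have "a = (\<integral>x. a \<partial>\<mu>)" by (simp add: prob_space)
  also have "\<dots> \<le> (\<integral>x. h x + (\<Sum>s\<in>T. \<bar>h (act s x) - h x\<bar>) \<partial>\<mu>)"
  proof (rule integral_mono)
    fix x
    obtain s where s: "s \<in> T" "act s x \<in> U" using T(2) by blast
    have "\<bar>h (act s x) - h x\<bar> \<le> (\<Sum>s\<in>T. \<bar>h (act s x) - h x\<bar>)"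
      using member_le_sum[OF s(1), of "\<lambda>s. \<bar>h (act s x) - h x\<bar>"] T(1) by simp
    then show "a \<le> h x + (\<Sum>s\<in>T. \<bar>h (act s x) - h x\<bar>)" using ge[OF s(2)] by linarith
  qed (simp, intro Bochner_Integration.integrable_add hi Bochner_Integration.integrable_sum di)
  also have "\<dots> = integral\<^sup>L \<mu> h + (\<Sum>s\<in>T. \<integral>x. \<bar>h (act s x) - h x\<bar> \<partial>\<mu>)"
    using hi di by (simp add: Bochner_Integration.integral_add Bochner_Integration.integral_sum
        Bochner_Integration.integrable_sum del: integrable_abs_iff)
  also have "\<dots> \<le> integral\<^sup>L \<mu> h + real (card T) * e"
    using sum_mono[of T "\<lambda>s. \<integral>x. \<bar>h (act s x) - h x\<bar> \<partial>\<mu>" "\<lambda>_. e"] inv by simp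
  finally show False using less by simp
qed

text \<open>
  The accuracy e of the almost invariant average is chosen after the finitely many translates that
  the given open sets need, so that the accumulated error stays below both gaps.
\<close>

lemma distinct_integrals_split_open_sets:
  fixes f :: "'k \<Rightarrow> real"
  assumes min: "minimal_system act"
    and \<mu>: "invariant_probability act \<mu>" and \<nu>: "invariant_probability act \<nu>"
    and f: "continuous_on UNIV f" and seq: "seq_compact_family (\<lambda>s x. f (act s x))"
    and a: "integral\<^sup>L \<mu> f < a" and b: "b < integral\<^sup>L \<nu> f"
  shows "splits_open_sets (function_hull (\<lambda>s x. f (act s x))) a b"
  unfolding splits_open_sets_def
proof (intro allI impI)
  fix \<U> :: "'k set set" assume \<U>: "finite \<U>" "\<forall>U\<in>\<U>. open U \<and> U \<noteq> {}"
  have "\<forall>U\<in>\<U>. \<exists>T. finite T \<and> (\<forall>x. \<exists>s\<in>T. act s x \<in> U)"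
    using minimal_finitely_many_visits[OF min] \<U>(2) by metis
  then obtain T where T: "\<And>U. U \<in> \<U> \<Longrightarrow> finite (T U)" "\<And>U x. U \<in> \<U> \<Longrightarrow> \<exists>s\<in>T U. act s x \<in> U"
    by metis
  define V where "V = (\<Union>U\<in>\<U>. T U)"
  have V: "finite V" unfolding V_def using \<U>(1) T(1) by blast
  have visit: "\<exists>s\<in>V. act s x \<in> U" if "U \<in> \<U>" for U x unfolding V_def using T(2)[OF that, of x] that by blast
  define e where "e = min (a - integral\<^sup>L \<mu> f) (integral\<^sup>L \<nu> f - b) / (real (card V) + 1)"
  have e: "0 < e" unfolding e_def using a b by simp
  have "(real (card V) + 1) * e = min (a - integral\<^sup>L \<mu> f) (integral\<^sup>L \<nu> f - b)" by (simp add: e_def)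
  then have small: "real (card V) * e < a - integral\<^sup>L \<mu> f" "real (card V) * e < integral\<^sup>L \<nu> f - b"
    using e by (auto simp: distrib_right min_def split: if_splits)
  obtain h where h: "h \<in> function_hull (\<lambda>s x. f (act s x))"
    and h\<mu>: "\<And>t. (\<integral>x. \<bar>h (act t x) - h x\<bar> \<partial>\<mu>) \<le> e" and h\<nu>: "\<And>t. (\<integral>x. \<bar>h (act t x) - h x\<bar> \<partial>\<nu>) \<le> e"
    using almost_invariant_average[OF \<mu> \<nu> f seq e] by metis
  have hc: "continuous_on UNIV h"
    using h unfolding function_hull_def by (auto intro!: continuous_intros continuous_orbit f)
  have "\<exists>x\<in>U. h x < a" if "U \<in> \<U>" for U
    using function_hull_orbit_integral[OF \<mu> f h] small(1)
    by (intro almost_invariant_dips[OF \<mu> hc V visit[OF that] h\<mu>]) simp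
  moreover have "\<exists>x\<in>U. b < h x" if "U \<in> \<U>" for U
  proof -
    have "\<exists>x\<in>U. - h x < - b"
    proof (rule almost_invariant_dips[OF \<nu> _ V visit[OF that]])
      show "continuous_on UNIV (\<lambda>x. - h x)" by (intro continuous_intros hc)
      show "(\<integral>x. \<bar>- h (act t x) - - h x\<bar> \<partial>\<nu>) \<le> e" for t using h\<nu>[of t] by (simp add: abs_minus_commute)
      show "integral\<^sup>L \<nu> (\<lambda>x. - h x) + real (card V) * e < - b"
        using function_hull_orbit_integral[OF \<nu> f h] small(2) by simp
    qed
    then show ?thesis by simp
  qed
  ultimately show "\<exists>h\<in>function_hull (\<lambda>s x. f (act s x)). \<forall>U\<in>\<U>. (\<exists>x\<in>U. h x < a) \<and> (\<exists>x\<in>U. b < h x)"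
    using h by blast
qed

lemma invariant_probability_integral_le:
  fixes f :: "'k \<Rightarrow> real"
  assumes metr: "metrizable_space (euclidean :: 'k topology)" and min: "minimal_system act"
    and \<mu>: "invariant_probability act \<mu>" and \<nu>: "invariant_probability act \<nu>"
    and f: "continuous_on UNIV f" and seq: "seq_compact_family (\<lambda>s x. f (act s x))"
  shows "integral\<^sup>L \<nu> f \<le> integral\<^sup>L \<mu> f"
proof (rule ccontr)
  assume "\<not> ?thesis"
  then obtain a where a: "integral\<^sup>L \<mu> f < a" "a < integral\<^sup>L \<nu> f" using dense by (metis not_le)
  obtain b where b: "a < b" "b < integral\<^sup>L \<nu> f" using dense[OF a(2)] by blast
  obtain B where B: "\<And>x. \<bar>f x\<bar> \<le> B" using continuous_bounded[OF compact_UNIV f] by blast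
  show False
    using hull_not_splitting[OF compact_UNIV metr continuous_orbit[OF f] B seq b(1)]
      distinct_integrals_split_open_sets[OF min \<mu> \<nu> f seq a(1) b(2)] by simp
qed

lemma exists_invariant_probability:
  "\<exists>\<mu>. regular_borel_probability \<mu> \<and> invariant_probability act \<mu>"
proof -
  fix x0 :: 'k
  have orbit: "(\<lambda>s. g (act s x0)) \<in> bcontfun" if g: "continuous_on UNIV g" for g :: "'k \<Rightarrow> real"
  proof -
    obtain B where B: "\<And>x. \<bar>g x\<bar> \<le> B" using continuous_bounded[OF compact_UNIV g] by blast
    have "continuous_on UNIV (\<lambda>s. g (act s x0))" by (rule continuous_in_semigroup[OF g]) blast
    then show ?thesis using B by (rule bcontfunI_real)
  qed
  interpret \<phi>: positive_functional "\<lambda>g. M (\<lambda>s. g (act s x0))"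
    by standard (simp_all add: compact_UNIV orbit add scale nonneg one)
  have "(\<integral>x. g (act s x) \<partial>\<phi>.riesz) = (\<integral>x. g x \<partial>\<phi>.riesz)"
    if g: "continuous_on UNIV g" for s and g :: "'k \<Rightarrow> real"
    using left[OF orbit[OF g], of s]
    by (simp add: \<phi>.integral_riesz[OF g] \<phi>.integral_riesz[OF continuous_orbit[OF g]] act_mult)
  then show ?thesis
    using \<phi>.regular_riesz \<phi>.prob_space_riesz \<phi>.sets_riesz unfolding invariant_probability_def by blast
qed

end

context topological_dynamical_system
begin

lemma invariant_probability_iff:
  assumes \<mu>: "regular_borel_probability \<mu>"
  shows "invariant_probability act \<mu> \<longleftrightarrow> invariant_measure act \<mu>"
proof
  have sets: "sets \<mu> = sets borel" and prob: "prob_space \<mu>" using \<mu> by (auto simp: regular_borel_probability_def)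
  {
    assume inv: "invariant_measure act \<mu>"
    have "(\<integral>x. f (act s x) \<partial>\<mu>) = (\<integral>x. f x \<partial>\<mu>)" if f: "continuous_on UNIV f" for s and f :: "'k \<Rightarrow> real"
    proof -
      have "continuous_on UNIV (\<lambda>x. complex_of_real (f x))" by (intro continuous_intros f)
      then have "integral\<^sup>L \<mu> (koopman act s (\<lambda>x. complex_of_real (f x))) = integral\<^sup>L \<mu> (\<lambda>x. complex_of_real (f x))"
        using inv unfolding invariant_measure_def by blast
      then show ?thesis by (simp add: koopman_def)
    qed
    then show "invariant_probability act \<mu>" using sets prob unfolding invariant_probability_def by blast
  next
    assume inv: "invariant_probability act \<mu>"
    show "invariant_measure act \<mu>"
      unfolding invariant_measure_def koopman_def
    proof (intro allI impI)
      fix s and f :: "'k \<Rightarrow> complex" assume f: "continuous_on UNIV f"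
      have ic: "integrable \<mu> g" if g: "continuous_on UNIV g" for g :: "'k \<Rightarrow> complex"
      proof -
        have "integrable \<mu> (\<lambda>x. complex_of_real (Re (g x)) + \<i> * complex_of_real (Im (g x)))"
          by (intro Bochner_Integration.integrable_add integrable_mult_right integrable_of_real
              integrable_continuous sets prob continuous_intros g)
        then show ?thesis by (simp add: complex_eq[symmetric])
      qed
      have fs: "continuous_on UNIV (\<lambda>x. f (act s x))"
        by (rule continuous_on_compose2[OF f continuous_act_point]) simp
      have re: "continuous_on UNIV (\<lambda>x. Re (f x))" and im: "continuous_on UNIV (\<lambda>x. Im (f x))"
        by (intro continuous_intros f)+
      have real_inv: "(\<integral>x. g (act s x) \<partial>\<mu>) = (\<integral>x. g x \<partial>\<mu>)" if "continuous_on UNIV g" for g :: "'k \<Rightarrow> real"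
        using inv that unfolding invariant_probability_def by blast
      show "(\<integral>x. f (act s x) \<partial>\<mu>) = integral\<^sup>L \<mu> f"
      proof (rule complex_eqI)
        show "Re (\<integral>x. f (act s x) \<partial>\<mu>) = Re (integral\<^sup>L \<mu> f)"
          using real_inv[OF re] unfolding integral_Re[OF ic[OF f]] integral_Re[OF ic[OF fs]] .
        show "Im (\<integral>x. f (act s x) \<partial>\<mu>) = Im (integral\<^sup>L \<mu> f)"
          using real_inv[OF im] unfolding integral_Im[OF ic[OF f]] integral_Im[OF ic[OF fs]] .
      qed
    qed
  }
qed

end

lemma tame_imp_seq_compact_family:
  fixes f :: "'k::topological_space \<Rightarrow> real"
  assumes tame: "tame (act :: 's \<Rightarrow> _)" and f: "continuous_on UNIV f"
  shows "seq_compact_family (\<lambda>s x. f (act s x))"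
  unfolding seq_compact_family_def
proof
  fix u :: "nat \<Rightarrow> 's"
  let ?g = "\<lambda>x. complex_of_real (f x)"
  have "continuous_on UNIV ?g" by (intro continuous_intros f)
  then have "relatively_seq_compact (range (\<lambda>s. koopman act s ?g))" using tame by (simp add: tame_def)
  then obtain l r where r: "strict_mono r" and l: "((\<lambda>n. koopman act (u n) ?g) \<circ> r) \<longlonglongrightarrow> l"
    unfolding relatively_seq_compact_def by (metis (mono_tags, lifting) image_subsetI rangeI)
  have "(\<lambda>n. f (act (u (r n)) x)) \<longlonglongrightarrow> Re (l x)" for x
  proof -
    have "(\<lambda>n. (\<lambda>g. g x) (((\<lambda>n. koopman act (u n) ?g) \<circ> r) n)) \<longlonglongrightarrow> (\<lambda>g. g x) l"
      by (rule continuous_on_tendsto_compose[OF continuous_on_product_coordinates[of x] l]) auto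
    then have "(\<lambda>n. complex_of_real (f (act (u (r n)) x))) \<longlonglongrightarrow> l x" by (simp add: koopman_def o_def)
    from tendsto_Re[OF this] show ?thesis by simp
  qed
  then show "\<exists>r l. strict_mono r \<and> (\<forall>x. (\<lambda>n. f (act (u (r n)) x)) \<longlonglongrightarrow> l x)"
    using r by (intro exI[of _ r] exI[of _ "\<lambda>x. Re (l x)"] conjI allI)
qed

section \<open>Unique ergodicity\<close>

theorem corollary5p4:
  fixes act :: "'s::semitopological_semigroup \<Rightarrow> 'k::t2_space \<Rightarrow> 'k"
  assumes "topological_dynamical_system act"
    and "metric_system act"
    and "minimal_system act"
    and "tame act"
    and "amenable TYPE('s)"
  shows "uniquely_ergodic act"
proof -
  obtain M :: "('s \<Rightarrow> real) \<Rightarrow> real" where M: "real_invariant_mean M"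
    using amenable_imp_real_invariant_mean[OF assms(5)] by blast
  interpret topological_dynamical_system act by (rule assms(1))
  interpret real_invariant_mean M by (rule M)
  interpret amenable_system act M ..
  have metr: "metrizable_space (euclidean :: 'k topology)" using assms(2) by (simp add: metric_system_def)
  have le: "integral\<^sup>L \<nu> f \<le> integral\<^sup>L \<mu> f"
    if "invariant_probability act \<mu>" "invariant_probability act \<nu>" "continuous_on UNIV f"
    for \<mu> \<nu> and f :: "'k \<Rightarrow> real"
    using that by (intro invariant_probability_integral_le metr assms(3) tame_imp_seq_compact_family assms(4))
  have unique: "\<mu> = \<nu>"
    if "regular_borel_probability \<mu>" "invariant_measure act \<mu>"
      "regular_borel_probability \<nu>" "invariant_measure act \<nu>" for \<mu> \<nu>
  proof (rule regular_borel_probability_eqI[OF compact_UNIV that(1,3)])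
    have "invariant_probability act \<mu>" "invariant_probability act \<nu>"
      using that by (simp_all add: invariant_probability_iff)
    then show "integral\<^sup>L \<mu> f = integral\<^sup>L \<nu> f" if "continuous_on UNIV f" for f :: "'k \<Rightarrow> real"
      using that by (intro antisym le)
  qed
  obtain \<mu> where "regular_borel_probability \<mu>" "invariant_measure act \<mu>"
    using exists_invariant_probability invariant_probability_iff by blast
  then show ?thesis unfolding uniquely_ergodic_def using unique by blast
qed

end
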